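(* Let $r \geq 4$ be an integer and define $t$ by: $t=r$ if $r \equiv 0 \pmod 4$; $t=r-1$ if $r \equiv 1 \pmod 2$; $t=r-2$ if $r \equiv 2 \pmod 4$. Then there are infinitely many $t$-edge-connected $r$-graphs which do not contain $r-2$ pairwise disjoint $1$-factors.
   Context: All graphs are finite and may have parallel edges but no loops. A graph is $r$-regular if every vertex has degree $r$. For $S \subseteq V(G)$, $\partial_G(S)$ denotes the set of edges with exactly one end in $S$. An $r$-graph is an $r$-regular graph $G$ such that $|\partial_G(S)| \geq r$ for every $S \subseteq V(G)$ with $|S|$ odd. A $1$-factor is a spanning $1$-regular subgraph (its edge set is a perfect matching); $1$-factors are pairwise disjoint if their edge sets are pairwise disjoint (parallel edges count as distinct edges). *)

theory Defs
  imports Main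
begin

text \<open>
  Finite loopless multigraphs: edges are objects of their own, so that parallel edges are
  distinct edges with the same set of ends. Values of \<open>ends\<close> outside \<open>edges\<close> are irrelevant.
\<close>

record ('v, 'e) mgraph =
  vertices :: "'v set"
  edges :: "'e set"
  ends :: "'e \<Rightarrow> 'v set"

definition multigraph :: "('v, 'e) mgraph \<Rightarrow> bool" where
  "multigraph G \<longleftrightarrow>
     finite (vertices G) \<and> finite (edges G) \<and>
     (\<forall>e\<in>edges G. ends G e \<subseteq> vertices G \<and> card (ends G e) = 2)"

definition degree :: "('v, 'e) mgraph \<Rightarrow> 'v \<Rightarrow> nat" where
  "degree G v = card {e \<in> edges G. v \<in> ends G e}"

definition regular :: "nat \<Rightarrow> ('v, 'e) mgraph \<Rightarrow> bool" where
  "regular r G \<longleftrightarrow> (\<forall>v\<in>vertices G. degree G v = r)"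

definition edge_boundary :: "('v, 'e) mgraph \<Rightarrow> 'v set \<Rightarrow> 'e set" where
  "edge_boundary G S = {e \<in> edges G. card (ends G e \<inter> S) = 1}"

definition r_graph :: "nat \<Rightarrow> ('v, 'e) mgraph \<Rightarrow> bool" where
  "r_graph r G \<longleftrightarrow>
     multigraph G \<and> regular r G \<and>
     (\<forall>S\<subseteq>vertices G. odd (card S) \<longrightarrow> r \<le> card (edge_boundary G S))"

definition adjacency :: "('v, 'e) mgraph \<Rightarrow> ('v \<times> 'v) set" where
  "adjacency G = {(u, v). \<exists>e\<in>edges G. ends G e = {u, v}}"

definition connected_graph :: "('v, 'e) mgraph \<Rightarrow> bool" where
  "connected_graph G \<longleftrightarrow>
     vertices G \<noteq> {} \<and> (\<forall>u\<in>vertices G. \<forall>v\<in>vertices G. (u, v) \<in> (adjacency G)\<^sup>*)"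

definition delete_edges :: "('v, 'e) mgraph \<Rightarrow> 'e set \<Rightarrow> ('v, 'e) mgraph" where
  "delete_edges G F = G\<lparr>edges := edges G - F\<rparr>"

definition edge_connected :: "nat \<Rightarrow> ('v, 'e) mgraph \<Rightarrow> bool" where
  "edge_connected t G \<longleftrightarrow>
     1 < card (vertices G) \<and>
     (\<forall>F\<subseteq>edges G. card F < t \<longrightarrow> connected_graph (delete_edges G F))"

definition spanning_subgraph :: "('v, 'e) mgraph \<Rightarrow> ('v, 'e) mgraph \<Rightarrow> bool" where
  "spanning_subgraph H G \<longleftrightarrow>
     vertices H = vertices G \<and> edges H \<subseteq> edges G \<and> (\<forall>e\<in>edges H. ends H e = ends G e)"

definition one_factor :: "('v, 'e) mgraph \<Rightarrow> ('v, 'e) mgraph \<Rightarrow> bool" where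
  "one_factor H G \<longleftrightarrow> spanning_subgraph H G \<and> regular 1 H"

definition has_disjoint_one_factors :: "nat \<Rightarrow> ('v, 'e) mgraph \<Rightarrow> bool" where
  "has_disjoint_one_factors k G \<longleftrightarrow>
     (\<exists>H :: nat \<Rightarrow> ('v, 'e) mgraph.
        (\<forall>i<k. one_factor (H i) G) \<and>
        (\<forall>i<k. \<forall>j<k. i \<noteq> j \<longrightarrow> edges (H i) \<inter> edges (H j) = {}))"

definition isomorphic :: "('v, 'e) mgraph \<Rightarrow> ('w, 'f) mgraph \<Rightarrow> bool" where
  "isomorphic G H \<longleftrightarrow>
     (\<exists>f g. bij_betw f (vertices G) (vertices H) \<and> bij_betw g (edges G) (edges H) \<and>
        (\<forall>e\<in>edges G. ends H (g e) = f ` ends G e))"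

text \<open>
  ``Infinitely many graphs'' means infinitely many up to isomorphism. Since every finite
  multigraph is isomorphic to one whose vertices and edges are natural numbers, it suffices to
  let the graphs range over this type.
\<close>

definition infinitely_many_graphs :: "((nat, nat) mgraph \<Rightarrow> bool) \<Rightarrow> bool" where
  "infinitely_many_graphs P \<longleftrightarrow>
     (\<exists>\<G>. infinite \<G> \<and> (\<forall>G\<in>\<G>. P G) \<and> (\<forall>G\<in>\<G>. \<forall>H\<in>\<G>. isomorphic G H \<longrightarrow> G = H))"

end

(* Idea. The Petersen graph has six perfect matchings M_0, ..., M_5; every edge lies in exactly two of
  them, and any two meet in exactly one edge, so its edges are the pairs {a,b}. Adding x_a copies of
  every M_a to the Petersen graph, with x_0 + ... + x_5 = r - 3, gives an r-graph in which r - 2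
  disjoint perfect matchings must consist of x_a copies of M_a for every a and one further copy of a
  single M_j. So exactly one edge of each class {a,b} is unused, or none if j is in {a,b}.

  Forking a vertex u of an r-graph, whose edges are partitioned into A and B, replaces u by two such
  graphs Q1, Q2 and a vertex h: a class P1 of |A| parallel edges p1 q1 of Q1 is redirected to h q1,
  the edges of A are moved to p1, and likewise for B and Q2. Edges keep their names, so by parity every
  perfect matching of the new graph restricts to perfect matchings of G, Q1 and Q2, and it uses A iff
  it uses P1. Consequently r - 2 disjoint perfect matchings leave exactly one edge of A and one edge
  of B unused. If |A| and |B| are at least t/2, cuts do not become too small.

  Five forks of one weighted Petersen graph force contradictory values of j. Every further fork then
  yields a larger example. *)

theory Submission
  imports Defs
begin

section \<open>Cuts of the Petersen graph\<close>

text \<open>Edge \<open>c\<close> of the Petersen graph has the ends \<open>pends ! c\<close> and lies in exactly the two perfect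
  matchings \<open>M\<^sub>a\<close>, \<open>M\<^sub>b\<close> with \<open>(a, b) = pairs ! c\<close>.\<close>

definition pairs :: "(nat \<times> nat) list" where
  "pairs = [(0,1),(0,2),(0,3),(0,4),(0,5),(1,2),(1,3),(1,4),(1,5),(2,3),(2,4),(2,5),(3,4),(3,5),(4,5)]"

definition pends :: "(nat \<times> nat) list" where
  "pends = [(0,1),(2,3),(4,5),(6,7),(8,9),(4,6),(2,8),(5,9),(3,7),(7,9),(0,8),(1,5),(1,3),(0,6),(2,4)]"

text \<open>The pairs of the edges crossing the cut with indicator list \<open>l\<close>; \<open>mult\<close> then counts the crossing
  edges of a given perfect matching.\<close>

definition crossed :: "bool list \<Rightarrow> (nat \<times> nat) list" where
  "crossed l = map snd (filter (\<lambda>((u,v),p). (l ! u) \<noteq> (l ! v)) (zip pends pairs))"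

definition mult :: "(nat \<times> nat) list \<Rightarrow> nat \<Rightarrow> nat" where
  "mult ps a = length (filter (\<lambda>(i,j). i = a \<or> j = a) ps)"

text \<open>Every perfect matching meets an odd cut oddly often and an even cut evenly often. So it
  meets an odd cut at least once, and both matchings through an edge of an even cut meet that cut at
  least twice. Moreover, at most two of the six miss a nontrivial even cut.\<close>

definition cut_check :: "bool list \<Rightarrow> bool" where
  "cut_check l = (let ps = crossed l in
     if odd (length (filter id l)) then length ps \<ge> 3 \<and> list_all (\<lambda>a. mult ps a \<ge> 1) [0..<6]
     else ps = [] \<or> (length ps \<ge> 4 \<and> list_ex (\<lambda>(i,j). list_all (\<lambda>a. mult ps a \<ge> 2 \<or> a = i \<or> a = j) [0..<6]) pairs
       \<and> list_all (\<lambda>(i,j). mult ps i \<ge> 2 \<and> mult ps j \<ge> 2) ps))"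

text \<open>A complete evaluation over the 1024 vertex sets of the Petersen graph.\<close>

lemma cut_check: "list_all cut_check (List.n_lists 10 [False,True])"
  by code_simp

section \<open>Perfect matchings and cuts\<close>

definition inc :: "('v, 'e) mgraph \<Rightarrow> 'v \<Rightarrow> 'e set" where
  "inc G v = {e \<in> edges G. v \<in> ends G e}"

definition perfect_matching :: "('v, 'e) mgraph \<Rightarrow> 'e set \<Rightarrow> bool" where
  "perfect_matching G M \<longleftrightarrow> M \<subseteq> edges G \<and> (\<forall>v\<in>vertices G. card (M \<inter> inc G v) = 1)"

text \<open>Disjoint 1-factors as bare edge sets, which are easily restricted to fewer edges; only
  the values \<open>N i\<close> with \<open>i < k\<close> matter.\<close>

definition matching_family :: "nat \<Rightarrow> ('v, 'e) mgraph \<Rightarrow> (nat \<Rightarrow> 'e set) \<Rightarrow> bool" where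
  "matching_family k G N \<longleftrightarrow> (\<forall>i<k. perfect_matching G (N i)) \<and>
     (\<forall>i<k. \<forall>j<k. i \<noteq> j \<longrightarrow> N i \<inter> N j = {})"

lemma one_factor_perfect_matching:
  assumes "one_factor H G"
  shows "perfect_matching G (edges H)"
proof -
  have sub: "edges H \<subseteq> edges G" and V: "vertices H = vertices G"
    and ends: "\<And>e. e \<in> edges H \<Longrightarrow> ends H e = ends G e"
    and reg: "\<And>v. v \<in> vertices H \<Longrightarrow> card {e \<in> edges H. v \<in> ends H e} = 1"
    using assms by (auto simp: one_factor_def spanning_subgraph_def regular_def degree_def)
  have "edges H \<inter> inc G v = {e \<in> edges H. v \<in> ends H e}" for v
    using sub ends by (auto simp: inc_def)
  with sub V reg show ?thesis by (simp add: perfect_matching_def)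
qed

lemma disjoint_one_factors_matching_family:
  assumes "has_disjoint_one_factors k G"
  shows "\<exists>N. matching_family k G N"
proof -
  obtain H where "\<forall>i<k. one_factor (H i) G"
    and "\<forall>i<k. \<forall>j<k. i \<noteq> j \<longrightarrow> edges (H i) \<inter> edges (H j) = {}"
    using assms by (auto simp: has_disjoint_one_factors_def)
  then have "matching_family k G (\<lambda>i. edges (H i))"
    by (simp add: matching_family_def one_factor_perfect_matching)
  then show ?thesis by blast
qed

text \<open>Double counting of the incidences between vertices and \<open>M\<close>; the source of
  the parity argument for forks.\<close>

lemma handshake:
  assumes "multigraph G" "M \<subseteq> edges G"
  shows "(\<Sum>v\<in>vertices G. card (M \<inter> inc G v)) = 2 * card M"
proof -
  have fin: "finite (vertices G)" "finite M"
    using assms finite_subset by (auto simp: multigraph_def)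
  have "card {v \<in> vertices G. v \<in> ends G e} = 2" if "e \<in> M" for e
  proof -
    have "{v \<in> vertices G. v \<in> ends G e} = ends G e" "card (ends G e) = 2"
      using that assms by (auto simp: multigraph_def)
    then show ?thesis by simp
  qed
  then have "(\<Sum>v\<in>vertices G. card {e \<in> M. v \<in> ends G e}) = 2 * card M"
    using sum_multicount[OF fin, where R = "\<lambda>v e. v \<in> ends G e"] by simp
  moreover have "M \<inter> inc G v = {e \<in> M. v \<in> ends G e}" for v
    using assms by (auto simp: inc_def)
  ultimately show ?thesis by simp
qed

lemma card_pair_Int_eq_1: "a \<noteq> b \<Longrightarrow> card ({a, b} \<inter> S) = 1 \<longleftrightarrow> (a \<in> S) \<noteq> (b \<in> S)"
  by (cases "a \<in> S"; cases "b \<in> S") auto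

lemma multigraph_ends:
  assumes "multigraph G" "e \<in> edges G"
  obtains a b where "ends G e = {a, b}" "a \<noteq> b" "a \<in> vertices G" "b \<in> vertices G"
proof -
  have "card (ends G e) = 2" "ends G e \<subseteq> vertices G"
    using assms by (auto simp: multigraph_def)
  then show ?thesis using that by (auto simp: card_2_iff)
qed

text \<open>Edge-connectivity is kept as a bound on all nontrivial cuts, because forking is
  controlled cut by cut. The even order drives the parity argument for matchings.\<close>

definition well_cut :: "nat \<Rightarrow> nat \<Rightarrow> ('v, 'e) mgraph \<Rightarrow> bool" where
  "well_cut r t G \<longleftrightarrow> r_graph r G \<and> even (card (vertices G)) \<and> 1 < card (vertices G) \<and>
     (\<forall>S\<subseteq>vertices G. S \<noteq> {} \<longrightarrow> S \<noteq> vertices G \<longrightarrow> t \<le> card (edge_boundary G S))"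

text \<open>If fewer than \<open>t\<close> edges are deleted, the component of a vertex has its
  whole boundary among the deleted edges, so this component is everything.\<close>

lemma well_cut_edge_connected:
  assumes "well_cut r t G"
  shows "edge_connected t G"
  unfolding edge_connected_def
proof (intro conjI allI impI)
  show "1 < card (vertices G)" using assms by (simp add: well_cut_def)
  fix F assume F: "F \<subseteq> edges G" "card F < t"
  have mg: "multigraph G" using assms by (simp add: well_cut_def r_graph_def)
  let ?D = "delete_edges G F"
  have finF: "finite F" using F mg finite_subset by (auto simp: multigraph_def)
  show "connected_graph ?D"
    unfolding connected_graph_def
  proof (intro conjI ballI)
    show "vertices ?D \<noteq> {}" using \<open>1 < card (vertices G)\<close> by (auto simp: delete_edges_def)
    fix u v assume "u \<in> vertices ?D" "v \<in> vertices ?D"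
    then have uv: "u \<in> vertices G" "v \<in> vertices G" by (auto simp: delete_edges_def)
    define S where "S = {x \<in> vertices G. (u, x) \<in> (adjacency ?D)\<^sup>*}"
    have "edge_boundary G S \<subseteq> F"
    proof (rule subsetI, rule ccontr)
      fix e assume e: "e \<in> edge_boundary G S" "e \<notin> F"
      then have eE: "e \<in> edges G" by (simp add: edge_boundary_def)
      obtain a b where ab: "ends G e = {a, b}" "a \<noteq> b" "a \<in> vertices G" "b \<in> vertices G"
        using multigraph_ends[OF mg eE] .
      have "(a, b) \<in> adjacency ?D" "(b, a) \<in> adjacency ?D"
        using eE e(2) ab(1) by (auto simp: adjacency_def delete_edges_def)
      then have "a \<in> S \<longleftrightarrow> b \<in> S"
        using ab unfolding S_def by (auto intro: rtrancl.rtrancl_into_rtrancl)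
      moreover have "(a \<in> S) \<noteq> (b \<in> S)"
        using e(1) ab card_pair_Int_eq_1[OF ab(2)] by (simp add: edge_boundary_def)
      ultimately show False by simp
    qed
    then have "card (edge_boundary G S) < t"
      using F(2) card_mono[OF finF] by (meson le_less_trans)
    moreover have "S \<subseteq> vertices G" "S \<noteq> {}" using uv by (auto simp: S_def)
    ultimately have "S = vertices G"
      using assms unfolding well_cut_def by (meson not_le)
    then show "(u, v) \<in> (adjacency ?D)\<^sup>*" using uv by (auto simp: S_def)
  qed
qed

section \<open>Forking a vertex\<close>

text \<open>\<open>P\<close> is the class of parallel edges that a fork redirects. By the last
  condition, an even cut separating \<open>p\<close> and \<open>q\<close> keeps at least
  \<open>card P\<close> edges when \<open>P\<close> is removed from it.\<close>

definition gadget :: "nat \<Rightarrow> nat \<Rightarrow> ('v, 'e) mgraph \<Rightarrow> 'v \<Rightarrow> 'v \<Rightarrow> 'e set \<Rightarrow> bool" where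
  "gadget r t Q p q P \<longleftrightarrow> well_cut r t Q \<and> p \<in> vertices Q \<and> q \<in> vertices Q \<and> p \<noteq> q \<and>
     P \<subseteq> edges Q \<and> (\<forall>e\<in>P. ends Q e = {p, q}) \<and>
     (\<forall>S\<subseteq>vertices Q. even (card S) \<longrightarrow> (p \<in> S) \<noteq> (q \<in> S) \<longrightarrow> 2 * card P \<le> card (edge_boundary Q S))"

definition crossing_count :: "('v, 'e) mgraph \<Rightarrow> 'e set \<Rightarrow> 'v set \<Rightarrow> nat" where
  "crossing_count G F S = card {e \<in> F. card (ends G e \<inter> S) = 1}"

text \<open>The new edge set is a plain union and only \<open>ends\<close> changes, so a matching of
  \<open>G'\<close> can be intersected with the old edge sets. The condition
  \<open>card P1 = card A\<close> preserves the degree of \<open>p1\<close>, and \<open>h\<close>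
  receives degree \<open>card A + card B = r\<close>.\<close>

locale fork =
  fixes r t :: nat and G G' Q1 Q2 :: "('v, 'e) mgraph" and u h p1 q1 p2 q2 :: 'v
    and A B P1 P2 :: "'e set"
  assumes G: "well_cut r t G" and u: "u \<in> vertices G"
    and AB: "A \<union> B = inc G u" "A \<inter> B = {}"
    and tA: "t \<le> 2 * card A" and tB: "t \<le> 2 * card B"
    and Q1: "gadget r t Q1 p1 q1 P1" and P1: "card P1 = card A"
    and Q2: "gadget r t Q2 p2 q2 P2" and P2: "card P2 = card B"
    and Vdisj: "vertices G \<inter> vertices Q1 = {}" "vertices G \<inter> vertices Q2 = {}"
      "vertices Q1 \<inter> vertices Q2 = {}"
    and h: "h \<notin> vertices G" "h \<notin> vertices Q1" "h \<notin> vertices Q2"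
    and Edisj: "edges G \<inter> edges Q1 = {}" "edges G \<inter> edges Q2 = {}" "edges Q1 \<inter> edges Q2 = {}"
    and V': "vertices G' = (vertices G - {u}) \<union> vertices Q1 \<union> vertices Q2 \<union> {h}"
    and E': "edges G' = edges G \<union> edges Q1 \<union> edges Q2"
    and ends_old: "\<And>e. e \<in> edges G - inc G u \<Longrightarrow> ends G' e = ends G e"
    and ends_A: "\<And>e. e \<in> A \<Longrightarrow> ends G' e = insert p1 (ends G e - {u})"
    and ends_B: "\<And>e. e \<in> B \<Longrightarrow> ends G' e = insert p2 (ends G e - {u})"
    and ends_Q1: "\<And>e. e \<in> edges Q1 - P1 \<Longrightarrow> ends G' e = ends Q1 e"
    and ends_Q2: "\<And>e. e \<in> edges Q2 - P2 \<Longrightarrow> ends G' e = ends Q2 e"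
    and ends_P1: "\<And>e. e \<in> P1 \<Longrightarrow> ends G' e = {h, q1}"
    and ends_P2: "\<And>e. e \<in> P2 \<Longrightarrow> ends G' e = {h, q2}"
begin

text \<open>The two sides are symmetric; this transfers every fact about \<open>A\<close>,
  \<open>Q1\<close>, \<open>P1\<close> to \<open>B\<close>, \<open>Q2\<close>,
  \<open>P2\<close>.\<close>

lemma swap: "fork r t G G' Q2 Q1 u h p2 q2 p1 q1 B A P2 P1"
  using G u AB tA tB Q1 P1 Q2 P2 Vdisj h Edisj V' E' ends_old ends_A ends_B ends_Q1 ends_Q2 ends_P1 ends_P2
  by unfold_locales (simp_all add: Un_ac Int_commute)

lemma mg: "multigraph G" "multigraph Q1" "multigraph Q2"
  using G Q1 Q2 by (auto simp: well_cut_def gadget_def r_graph_def)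

lemma fin: "finite (vertices G)" "finite (edges G)" "finite (vertices Q1)" "finite (edges Q1)"
  "finite (vertices Q2)" "finite (edges Q2)"
  using mg by (auto simp: multigraph_def)

lemma p1q1: "p1 \<in> vertices Q1" "q1 \<in> vertices Q1" "p1 \<noteq> q1" "P1 \<subseteq> edges Q1"
  "\<And>e. e \<in> P1 \<Longrightarrow> ends Q1 e = {p1, q1}"
  using Q1 by (auto simp: gadget_def)

lemma ends_sub: "e \<in> edges G \<Longrightarrow> ends G e \<subseteq> vertices G" "e \<in> edges Q1 \<Longrightarrow> ends Q1 e \<subseteq> vertices Q1"
  "e \<in> edges Q2 \<Longrightarrow> ends Q2 e \<subseteq> vertices Q2"
  using mg by (auto simp: multigraph_def)

lemma AB_sub: "A \<subseteq> edges G" "B \<subseteq> edges G"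
  using AB by (auto simp: inc_def)

lemma A_ends:
  assumes "e \<in> A"
  obtains x where "ends G e = {u, x}" "x \<noteq> u" "x \<in> vertices G" "ends G' e = {p1, x}"
proof -
  have eE: "e \<in> edges G" "u \<in> ends G e" using assms AB by (auto simp: inc_def)
  obtain a b where ab: "ends G e = {a, b}" "a \<noteq> b" "a \<in> vertices G" "b \<in> vertices G"
    using multigraph_ends[OF mg(1) eE(1)] .
  then consider "u = a" | "u = b" using eE(2) by auto
  then show ?thesis
    by cases (use that ab ends_A[OF assms] in \<open>auto simp: insert_Diff_if\<close>)
qed

lemma ends_Q1_sub: "e \<in> edges Q1 \<Longrightarrow> ends G' e \<subseteq> insert h (vertices Q1)"
  using ends_Q1[of e] ends_P1[of e] ends_sub(2)[of e] p1q1 by (cases "e \<in> P1") auto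

lemma ends_A_sub: "e \<in> A \<Longrightarrow> ends G' e \<subseteq> insert p1 (vertices G - {u})"
  by (erule A_ends) auto

lemmas ends_Q2_sub = fork.ends_Q1_sub[OF swap]
lemmas ends_B_sub = fork.ends_A_sub[OF swap]
lemmas p2q2 = fork.p1q1[OF swap]

lemma edge_cases:
  assumes "e \<in> edges G'"
  obtains "e \<in> A" | "e \<in> B" | "e \<in> edges G - inc G u" | "e \<in> edges Q1" | "e \<in> edges Q2"
  using assms AB E' by blast

lemma inc_old:
  assumes "v \<in> vertices G - {u}"
  shows "inc G' v = inc G v"
proof -
  have v: "v \<notin> insert h (vertices Q1)" "v \<notin> insert h (vertices Q2)" "v \<noteq> p1" "v \<noteq> p2" "v \<noteq> u"
    using assms Vdisj h p1q1 p2q2 by auto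
  have "v \<in> ends G' e \<longleftrightarrow> e \<in> edges G \<and> v \<in> ends G e" if "e \<in> edges G'" for e
    using that
  proof (cases rule: edge_cases)
    case 1 then show ?thesis using ends_A v AB_sub by auto
  next
    case 2 then show ?thesis using ends_B v AB_sub by auto
  next
    case 3 then show ?thesis using ends_old by auto
  next
    case 4 then show ?thesis using ends_Q1_sub v Edisj by auto
  next
    case 5 then show ?thesis using ends_Q2_sub v Edisj by auto
  qed
  then show ?thesis using E' by (auto simp: inc_def)
qed

lemma not_inc_Q1:
  assumes "v \<in> vertices Q1" "e \<in> edges G'" "e \<notin> edges Q1" "e \<notin> A"
  shows "v \<notin> ends G' e"
proof -
  have v: "v \<notin> insert h (vertices Q2)" "v \<notin> vertices G" "v \<noteq> p2"
    using assms Vdisj h p1q1 p2q2 by auto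
  from assms(2) show ?thesis
  proof (cases rule: edge_cases)
    case 2 then show ?thesis using ends_B_sub v by auto
  next
    case 3 then show ?thesis using ends_old ends_sub v by auto
  next
    case 5 then show ?thesis using ends_Q2_sub v by auto
  qed (use assms in auto)
qed

lemma inc_Q1:
  assumes "v \<in> vertices Q1 - {p1}"
  shows "inc G' v = inc Q1 v"
proof -
  have "v \<in> ends G' e \<longleftrightarrow> v \<in> ends Q1 e" if "e \<in> edges Q1" for e
    using that assms ends_Q1[of e] ends_P1[of e] p1q1(5)[of e] h by (cases "e \<in> P1") auto
  moreover have "v \<notin> ends G' e" if "e \<in> A" for e
    using ends_A_sub[OF that] assms Vdisj by auto
  ultimately show ?thesis using not_inc_Q1[of v] assms E' by (auto simp: inc_def)
qed

lemma inc_p1: "inc G' p1 = (inc Q1 p1 - P1) \<union> A"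
proof -
  have "p1 \<in> ends G' e \<longleftrightarrow> p1 \<in> ends Q1 e \<and> e \<notin> P1" if "e \<in> edges Q1" for e
    using that ends_Q1[of e] ends_P1[of e] p1q1 h by (cases "e \<in> P1") auto
  then show ?thesis using not_inc_Q1[of p1] p1q1 E' ends_A AB_sub by (auto simp: inc_def)
qed

lemma inc_h: "inc G' h = P1 \<union> P2"
proof -
  have "h \<in> ends G' e \<longleftrightarrow> e \<in> P1 \<union> P2" if "e \<in> edges G'" for e
    using that
  proof (cases rule: edge_cases)
    case 1 then show ?thesis using ends_A_sub[of e] h p1q1 p2q2 Edisj AB_sub by auto
  next
    case 2 then show ?thesis using ends_B_sub[of e] h p1q1 p2q2 Edisj AB_sub by auto
  next
    case 3 then show ?thesis using ends_old[of e] ends_sub h p1q1 p2q2 Edisj by auto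
  next
    case 4 then show ?thesis
      using ends_Q1[of e] ends_P1[of e] ends_sub(2)[of e] h p1q1 p2q2 Edisj by (cases "e \<in> P1") auto
  next
    case 5 then show ?thesis
      using ends_Q2[of e] ends_P2[of e] ends_sub(3)[of e] h p1q1 p2q2 Edisj by (cases "e \<in> P2") auto
  qed
  then show ?thesis using p1q1 p2q2 E' by (auto simp: inc_def)
qed

lemma P1_inc: "P1 \<subseteq> inc Q1 p1" "P1 \<subseteq> inc Q1 q1"
  using p1q1 by (auto simp: inc_def)

lemma wf_A: "e \<in> A \<Longrightarrow> ends G' e \<subseteq> vertices G' \<and> card (ends G' e) = 2"
proof (erule A_ends)
  fix x assume "ends G e = {u, x}" and x: "x \<noteq> u" "x \<in> vertices G" "ends G' e = {p1, x}"
  have "x \<noteq> p1" using x(2) Vdisj(1) p1q1(1) by blast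
  then show ?thesis using x p1q1(1) V' by simp
qed

lemma wf_Q1: "e \<in> edges Q1 \<Longrightarrow> ends G' e \<subseteq> vertices G' \<and> card (ends G' e) = 2"
proof (cases "e \<in> P1")
  case True
  have "h \<noteq> q1" using h(2) p1q1(2) by blast
  then show ?thesis using ends_P1[OF True] p1q1(2) V' by simp
next
  case False
  assume "e \<in> edges Q1"
  then show ?thesis using False ends_Q1[of e] mg(2) V' by (auto simp: multigraph_def)
qed

lemma multigraph: "multigraph G'"
proof -
  have "ends G' e \<subseteq> vertices G' \<and> card (ends G' e) = 2" if "e \<in> edges G'" for e
    using that
  proof (cases rule: edge_cases)
    case 1 then show ?thesis by (rule wf_A)
  next
    case 2 then show ?thesis using fork.wf_A[OF swap] by blast
  next
    case 3 then show ?thesis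
      using ends_old[of e] ends_sub(1)[of e] mg(1) V' by (auto simp: inc_def multigraph_def)
  next
    case 4 then show ?thesis by (rule wf_Q1)
  next
    case 5 then show ?thesis using fork.wf_Q1[OF swap] by blast
  qed
  then show ?thesis using fin V' E' by (auto simp: multigraph_def)
qed

lemma degs: "v \<in> vertices G \<Longrightarrow> card (inc G v) = r" "v \<in> vertices Q1 \<Longrightarrow> card (inc Q1 v) = r"
  using G Q1 by (auto simp: well_cut_def gadget_def r_graph_def regular_def degree_def inc_def)

lemma finA: "finite A" "finite B" "finite P1" "finite P2" "finite (inc Q1 v)" "finite (inc G v)"
  using AB_sub p1q1(4) p2q2(4) fin finite_subset by (auto simp: inc_def)

lemma cardAB: "card A + card B = r"
  using card_Un_disjoint[OF finA(1,2) AB(2)] AB(1) degs(1)[OF u] by simp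

lemma deg_Q1: "v \<in> vertices Q1 \<Longrightarrow> card (inc G' v) = r"
proof (cases "v = p1")
  case True
  have "card (inc G' p1) = card (inc Q1 p1 - P1) + card A"
    unfolding inc_p1 using finA Edisj AB_sub by (intro card_Un_disjoint) (auto simp: inc_def)
  also have "\<dots> = card (inc Q1 p1)"
    using card_Diff_subset[OF finA(3) P1_inc(1)] card_mono[OF finA(5) P1_inc(1)] P1 by simp
  finally show ?thesis using True p1q1 degs by simp
next
  case False
  assume "v \<in> vertices Q1"
  then show ?thesis using False inc_Q1 degs by simp
qed

lemmas deg_Q2 = fork.deg_Q1[OF swap]

lemma regular: "regular r G'"
proof -
  have "card (inc G' h) = r"
    using inc_h card_Un_disjoint[OF finA(3,4)] p1q1(4) p2q2(4) Edisj P1 P2 cardAB by fastforce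
  then have "card (inc G' v) = r" if "v \<in> vertices G'" for v
    using that V' deg_Q1 deg_Q2 inc_old[of v] degs(1)[of v] by auto
  then show ?thesis by (simp add: regular_def degree_def inc_def)
qed

lemma card_vertices: "card (vertices G') = card (vertices G) + card (vertices Q1) + card (vertices Q2)"
proof -
  have "card (vertices G') = card (vertices G - {u}) + card (vertices Q1) + card (vertices Q2) + 1"
  proof -
    have "card ((vertices G - {u}) \<union> vertices Q1) = card (vertices G - {u}) + card (vertices Q1)"
      using fin Vdisj by (intro card_Un_disjoint) auto
    moreover have "card (((vertices G - {u}) \<union> vertices Q1) \<union> vertices Q2) =
        card ((vertices G - {u}) \<union> vertices Q1) + card (vertices Q2)"
      using fin Vdisj by (intro card_Un_disjoint) auto
    ultimately show ?thesis unfolding V' using fin h by simp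
  qed
  moreover have "card (vertices G - {u}) + 1 = card (vertices G)"
    using card_Suc_Diff1[OF fin(1) u] by simp
  ultimately show ?thesis by simp
qed

section \<open>Perfect matchings of the forked graph\<close>

text \<open>Each vertex of \<open>Q1\<close> meets \<open>M\<close> once in \<open>G'\<close>.
  Compared with the incidences inside \<open>Q1\<close>, the vertex \<open>p1\<close> has lost the
  edges of \<open>M\<close> in \<open>P1\<close> and gained those in \<open>A\<close>. As
  \<open>Q1\<close> has even order, these two numbers have the same parity; both are at most 1,
  since \<open>A\<close> lies at \<open>p1\<close> and \<open>P1\<close> at
  \<open>q1\<close>.\<close>

lemma card_matching_A_P1:
  assumes "perfect_matching G' M"
  shows "card (M \<inter> A) = card (M \<inter> P1)" "card (M \<inter> A) \<le> 1"
proof -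
  have M: "\<And>v. v \<in> vertices G' \<Longrightarrow> card (M \<inter> inc G' v) = 1"
    and MG': "M \<subseteq> edges G'"
    using assms by (auto simp: perfect_matching_def)
  have finM: "finite M" using MG' multigraph finite_subset by (auto simp: multigraph_def)
  have V1: "vertices Q1 \<subseteq> vertices G'" using V' by auto
  have p: "card (M \<inter> (inc Q1 p1 - P1)) + card (M \<inter> A) = card (M \<inter> inc G' p1)"
    unfolding inc_p1 Int_Un_distrib using finM Edisj AB_sub
    by (intro card_Un_disjoint[symmetric]) (auto simp: inc_def)
  have q: "card (M \<inter> inc Q1 p1) = card (M \<inter> (inc Q1 p1 - P1)) + card (M \<inter> P1)"
    using P1_inc finM by (subst card_Un_disjoint[symmetric]) (auto intro!: arg_cong[where f=card])
  have "card (vertices Q1) = (\<Sum>v\<in>vertices Q1. card (M \<inter> inc G' v))"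
    using M V1 by (simp add: subset_iff)
  also have "\<dots> = card (M \<inter> inc G' p1) + (\<Sum>v\<in>vertices Q1 - {p1}. card (M \<inter> inc G' v))"
    using p1q1 fin by (subst sum.remove[of _ p1]) auto
  also have "(\<Sum>v\<in>vertices Q1 - {p1}. card (M \<inter> inc G' v)) = (\<Sum>v\<in>vertices Q1 - {p1}. card (M \<inter> inc Q1 v))"
    using inc_Q1 by (intro sum.cong) auto
  \<comment> \<open>Adding \<open>card (M \<inter> P1)\<close> completes the star of
    \<open>p1\<close> in \<open>Q1\<close>, so that \<open>handshake\<close> applies to
    \<open>Q1\<close>.\<close>
  finally have "card (vertices Q1) + card (M \<inter> P1) =
      card (M \<inter> A) + (card (M \<inter> inc Q1 p1) + (\<Sum>v\<in>vertices Q1 - {p1}. card (M \<inter> inc Q1 v)))"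
    using p q by simp
  also have "(card (M \<inter> inc Q1 p1) + (\<Sum>v\<in>vertices Q1 - {p1}. card (M \<inter> inc Q1 v)))
      = (\<Sum>v\<in>vertices Q1. card (M \<inter> inc Q1 v))"
    using p1q1 fin by (subst sum.remove[of _ p1]) auto
  also have "\<dots> = (\<Sum>v\<in>vertices Q1. card ((M \<inter> edges Q1) \<inter> inc Q1 v))"
    by (intro sum.cong arg_cong[where f=card]) (auto simp: inc_def)
  also have "\<dots> = 2 * card (M \<inter> edges Q1)" by (rule handshake[OF mg(2)]) auto
  finally have eq: "card (vertices Q1) + card (M \<inter> P1) = card (M \<inter> A) + 2 * card (M \<inter> edges Q1)" .
  have "even (card (vertices Q1))" using Q1 by (simp add: gadget_def well_cut_def)
  with eq have par: "even (card (M \<inter> P1)) = even (card (M \<inter> A))" by presburger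
  show A1: "card (M \<inter> A) \<le> 1" using p M[of p1] p1q1 V1 by auto
  have "card (M \<inter> P1) \<le> card (M \<inter> inc Q1 q1)"
    using P1_inc finM by (intro card_mono) auto
  then have "card (M \<inter> P1) \<le> 1" using inc_Q1[of q1] M[of q1] p1q1 V1 by auto
  with A1 par show "card (M \<inter> A) = card (M \<inter> P1)"
    by (metis le_neq_implies_less less_one odd_one even_zero)
qed

text \<open>Only the star of \<open>p1\<close> needs care: \<open>A\<close> has replaced
  \<open>P1\<close> there, and \<open>M\<close> uses both equally often.\<close>

lemma matching_Q1:
  assumes "perfect_matching G' M"
  shows "perfect_matching Q1 (M \<inter> edges Q1)"
  unfolding perfect_matching_def
proof (intro conjI ballI)
  fix v assume v: "v \<in> vertices Q1"
  have finM: "finite M"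
    using assms multigraph finite_subset by (auto simp: multigraph_def perfect_matching_def)
  have M: "card (M \<inter> inc G' v) = 1" using assms v V' by (simp add: perfect_matching_def)
  have eq: "M \<inter> edges Q1 \<inter> inc Q1 v = M \<inter> inc Q1 v" by (auto simp: inc_def)
  show "card (M \<inter> edges Q1 \<inter> inc Q1 v) = 1"
  proof (cases "v = p1")
    case True
    have "card (M \<inter> (inc Q1 p1 - P1)) + card (M \<inter> A) = card (M \<inter> inc G' p1)"
      unfolding inc_p1 Int_Un_distrib using finM Edisj AB_sub
      by (intro card_Un_disjoint[symmetric]) (auto simp: inc_def)
    moreover have "card (M \<inter> inc Q1 p1) = card (M \<inter> (inc Q1 p1 - P1)) + card (M \<inter> P1)"
      using P1_inc finM by (subst card_Un_disjoint[symmetric]) (auto intro!: arg_cong[where f=card])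
    ultimately show ?thesis using True eq M card_matching_A_P1[OF assms] by simp
  next
    case False then show ?thesis using inc_Q1[of v] v M eq by simp
  qed
qed auto

text \<open>At \<open>u\<close> the matching uses \<open>A\<close> and \<open>B\<close> together as
  often as \<open>P1\<close> and \<open>P2\<close>, and these form the star of
  \<open>h\<close>.\<close>

lemma matching_G:
  assumes "perfect_matching G' M"
  shows "perfect_matching G (M \<inter> edges G)"
  unfolding perfect_matching_def
proof (intro conjI ballI)
  fix v assume v: "v \<in> vertices G"
  have finM: "finite M"
    using assms multigraph finite_subset by (auto simp: multigraph_def perfect_matching_def)
  have eq: "M \<inter> edges G \<inter> inc G v = M \<inter> inc G v" by (auto simp: inc_def)
  show "card (M \<inter> edges G \<inter> inc G v) = 1"
  proof (cases "v = u")
    case True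
    have "card (M \<inter> inc G u) = card (M \<inter> A) + card (M \<inter> B)"
      unfolding AB(1)[symmetric] Int_Un_distrib using finM AB
      by (intro card_Un_disjoint) auto
    also have "\<dots> = card (M \<inter> P1) + card (M \<inter> P2)"
      using card_matching_A_P1[OF assms] fork.card_matching_A_P1[OF swap assms] by simp
    also have "\<dots> = card (M \<inter> inc G' h)"
      unfolding inc_h Int_Un_distrib using finM p1q1(4) p2q2(4) Edisj
      by (intro card_Un_disjoint[symmetric]) auto
    also have "\<dots> = 1" using assms V' by (simp add: perfect_matching_def)
    finally show ?thesis using True eq by simp
  next
    case False
    then have "v \<in> vertices G'" using v V' by simp
    then have "card (M \<inter> inc G' v) = 1" using assms by (simp add: perfect_matching_def)
    then show ?thesis using False inc_old[of v] v eq by simp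
  qed
qed auto

end

section \<open>Cuts of the forked graph\<close>

lemma crossing_Un:
  assumes "finite E1" "finite E2" "E1 \<inter> E2 = {}"
  shows "crossing_count H (E1 \<union> E2) T = crossing_count H E1 T + crossing_count H E2 T"
proof -
  have "{e \<in> E1 \<union> E2. card (ends H e \<inter> T) = 1} =
      {e \<in> E1. card (ends H e \<inter> T) = 1} \<union> {e \<in> E2. card (ends H e \<inter> T) = 1}" by auto
  then show ?thesis
    unfolding crossing_count_def using assms by (simp add: card_Un_disjoint disjoint_iff)
qed

text \<open>Arithmetic for one side of a fork. Here \<open>w\<close> is \<open>card A\<close>,
  \<open>n\<close> is the number of vertices of \<open>Q1\<close> in \<open>S\<close>, the truth
  values \<open>p\<close>, \<open>q\<close>, \<open>h\<close> tell whether \<open>p1\<close>,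
  \<open>q1\<close>, \<open>h\<close> lie in \<open>S\<close>, and \<open>s\<close> whether
  \<open>u\<close> lies in the compared cut of \<open>G\<close>. The edges of \<open>A\<close>
  contribute \<open>a\<close> to the cut of \<open>G\<close> and \<open>x\<close> to that of
  \<open>G'\<close>; those of \<open>Q1\<close> contribute \<open>y\<close> in \<open>G'\<close> and
  \<open>c\<close> in \<open>Q1\<close>.\<close>

lemma side_cut:
  fixes a x y c w r n :: nat and p q h s :: bool
  assumes "a \<le> x + (if p \<noteq> s then w else 0)"
    and "y + (if p \<noteq> q then w else 0) = c + (if q \<noteq> h then w else 0)"
    and "odd n \<longrightarrow> r \<le> c" and "even n \<longrightarrow> p \<noteq> q \<longrightarrow> 2 * w \<le> c"
  shows "even n \<Longrightarrow> s = h \<Longrightarrow> a \<le> x + y"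
    and "even n \<Longrightarrow> s \<noteq> h \<Longrightarrow> a \<le> x + y + w"
    and "odd n \<Longrightarrow> s = h \<Longrightarrow> a + r \<le> x + y + 2 * w"
    and "odd n \<Longrightarrow> s \<noteq> h \<Longrightarrow> a + r \<le> x + y + w"
  using assms by - (auto split: if_splits)

text \<open>The same notation when the compared cut of \<open>G\<close> is trivial, which determines
  \<open>x\<close>. The alternative \<open>c < t \<and> p = s\<close> is the case that
  \<open>S\<close> may be trivial on this side as well. The alternative \<open>x + y = w\<close> is
  harmless: the other side, being odd, contributes at least \<open>w\<close> too, and
  \<open>t \<le> 2 * w\<close>.\<close>

lemma side_cut_trivial:
  fixes x y c w r t n :: nat and p q h s :: bool
  assumes "x = (if p \<noteq> s then w else 0)"
    and "y + (if p \<noteq> q then w else 0) = c + (if q \<noteq> h then w else 0)"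
    and "odd n \<longrightarrow> r \<le> c" and "even n \<longrightarrow> p \<noteq> q \<longrightarrow> 2 * w \<le> c"
    and "c < t \<longrightarrow> p = q \<and> even n" and "t \<le> 2 * w"
  shows "s = h \<Longrightarrow> t \<le> x + y \<or> c < t \<and> p = s"
    and "odd n \<Longrightarrow> s \<noteq> h \<Longrightarrow> r \<le> x + y + w"
    and "even n \<Longrightarrow> s \<noteq> h \<Longrightarrow> t \<le> x + y + w \<or> x + y = w"
  using assms by - (fastforce simp: not_less add.commute split: if_splits)+

context fork begin

definition base_cut :: "'v set \<Rightarrow> bool \<Rightarrow> 'v set" where
  "base_cut S s = (S \<inter> (vertices G - {u})) \<union> (if s then {u} else {})"

text \<open>If \<open>p1\<close> has the status of \<open>u\<close>, an edge of \<open>A\<close>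
  crosses both cuts or neither; otherwise the summand \<open>card A\<close> pays for all of
  \<open>A\<close>.\<close>

lemma crossing_A:
  "crossing_count G A (base_cut S s) \<le> crossing_count G' A S + (if (p1 \<in> S) \<noteq> s then card A else 0)"
proof (cases "(p1 \<in> S) = s")
  case True
  have "card (ends G e \<inter> base_cut S s) = 1 \<longleftrightarrow> card (ends G' e \<inter> S) = 1" if "e \<in> A" for e
    using that
  proof (rule A_ends)
    fix x assume x: "ends G e = {u, x}" "x \<noteq> u" "x \<in> vertices G" "ends G' e = {p1, x}"
    have "x \<noteq> p1" using x(3) Vdisj(1) p1q1(1) by blast
    then show ?thesis
      unfolding x(1,4) using card_pair_Int_eq_1[of u x] card_pair_Int_eq_1[of p1 x] x True
      by (auto simp: base_cut_def)
  qed
  then have "crossing_count G A (base_cut S s) = crossing_count G' A S"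
    unfolding crossing_count_def by (intro arg_cong[where f = card]) auto
  then show ?thesis by simp
next
  case False
  have "crossing_count G A (base_cut S s) \<le> card A"
    unfolding crossing_count_def using finA by (intro card_mono) auto
  then show ?thesis using False by simp
qed

text \<open>When all old vertices other than \<open>u\<close> have status \<open>s\<close>, the
  status of \<open>p1\<close> alone decides.\<close>

lemma crossing_A_trivial:
  assumes "S \<inter> (vertices G - {u}) = (if s then vertices G - {u} else {})"
  shows "crossing_count G' A S = (if (p1 \<in> S) \<noteq> s then card A else 0)"
proof -
  have "card (ends G' e \<inter> S) = 1 \<longleftrightarrow> (p1 \<in> S) \<noteq> s" if "e \<in> A" for e
    using that
  proof (rule A_ends)
    fix x assume x: "ends G e = {u, x}" "x \<noteq> u" "x \<in> vertices G" "ends G' e = {p1, x}"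
    have "x \<noteq> p1" using x(3) Vdisj(1) p1q1(1) by blast
    moreover have "x \<in> S \<longleftrightarrow> s" using assms x(2,3) by (auto split: if_splits)
    ultimately show ?thesis
      unfolding x(4) using card_pair_Int_eq_1[of p1 x] by auto
  qed
  then have "{e \<in> A. card (ends G' e \<inter> S) = 1} = (if (p1 \<in> S) \<noteq> s then A else {})" by auto
  then show ?thesis by (simp add: crossing_count_def)
qed

lemma crossing_old:
  "crossing_count G (edges G - inc G u) (base_cut S s) = crossing_count G' (edges G - inc G u) S"
proof -
  have "ends G e \<inter> base_cut S s = ends G' e \<inter> S" if "e \<in> edges G - inc G u" for e
    using that ends_old[OF that] ends_sub(1)[of e] by (auto simp: base_cut_def inc_def)
  then show ?thesis unfolding crossing_count_def by (intro arg_cong[where f = card]) auto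
qed

text \<open>\<open>P1\<close> is the only class of \<open>Q1\<close> whose ends change, from
  \<open>p1\<close>, \<open>q1\<close> to \<open>h\<close>, \<open>q1\<close>. The additive form
  avoids subtraction of natural numbers.\<close>

lemma crossing_Q1:
  "crossing_count G' (edges Q1) S + (if (p1 \<in> S) \<noteq> (q1 \<in> S) then card A else 0) =
   card (edge_boundary Q1 (S \<inter> vertices Q1)) + (if (q1 \<in> S) \<noteq> (h \<in> S) then card A else 0)"
proof -
  have split: "crossing_count H (edges Q1) T = crossing_count H (edges Q1 - P1) T + crossing_count H P1 T" for H T
  proof -
    have "edges Q1 - P1 \<union> P1 = edges Q1" "(edges Q1 - P1) \<inter> P1 = {}" using p1q1(4) by blast+
    then show ?thesis using crossing_Un[of "edges Q1 - P1" P1 H T] fin finA by simp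
  qed
  have const: "crossing_count H P1 T = (if (a \<in> T) \<noteq> (b \<in> T) then card A else 0)"
    if "\<And>e. e \<in> P1 \<Longrightarrow> ends H e = {a, b}" "a \<noteq> b" for H T a b
  proof -
    have "{e \<in> P1. card (ends H e \<inter> T) = 1} = (if (a \<in> T) \<noteq> (b \<in> T) then P1 else {})"
      using that(1) card_pair_Int_eq_1[OF that(2)] by auto
    then show ?thesis using P1 by (simp add: crossing_count_def)
  qed
  have "h \<noteq> q1" using h(2) p1q1(2) by blast
  note c' = const[of G' h q1 S, OF ends_P1 this]
  note c = const[of Q1 p1 q1 "S \<inter> vertices Q1", OF p1q1(5) p1q1(3)]
  have "ends G' e \<inter> S = ends Q1 e \<inter> (S \<inter> vertices Q1)" if "e \<in> edges Q1 - P1" for e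
    using ends_Q1[OF that] ends_sub(2)[of e] that by auto
  then have "crossing_count G' (edges Q1 - P1) S = crossing_count Q1 (edges Q1 - P1) (S \<inter> vertices Q1)"
    unfolding crossing_count_def by (intro arg_cong[where f = card]) auto
  moreover have "card (edge_boundary Q1 (S \<inter> vertices Q1)) = crossing_count Q1 (edges Q1) (S \<inter> vertices Q1)"
    by (simp add: edge_boundary_def crossing_count_def)
  ultimately show ?thesis using split[of G' S] split[of Q1 "S \<inter> vertices Q1"] c c' p1q1(1,2) by auto
qed

lemma gadget_cuts:
  "odd (card (S \<inter> vertices Q1)) \<Longrightarrow> r \<le> card (edge_boundary Q1 (S \<inter> vertices Q1))"
  "S \<inter> vertices Q1 \<noteq> {} \<Longrightarrow> S \<inter> vertices Q1 \<noteq> vertices Q1 \<Longrightarrow>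
    t \<le> card (edge_boundary Q1 (S \<inter> vertices Q1))"
  "even (card (S \<inter> vertices Q1)) \<Longrightarrow> (p1 \<in> S) \<noteq> (q1 \<in> S) \<Longrightarrow>
    2 * card A \<le> card (edge_boundary Q1 (S \<inter> vertices Q1))"
  using Q1 P1 p1q1(1,2) unfolding gadget_def well_cut_def r_graph_def by auto

lemma cut_fork:
  "card (edge_boundary G' S) = crossing_count G' A S + crossing_count G' B S +
     crossing_count G' (edges G - inc G u) S + crossing_count G' (edges Q1) S + crossing_count G' (edges Q2) S"
proof -
  have "edges G' = A \<union> B \<union> (edges G - inc G u) \<union> edges Q1 \<union> edges Q2"
    unfolding E' AB(1) by (auto simp: inc_def)
  moreover have "card (edge_boundary G' S) = crossing_count G' (edges G') S"
    by (simp add: edge_boundary_def crossing_count_def)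
  moreover have "(A \<union> B) \<inter> (edges G - inc G u) = {}" using AB(1) by auto
  moreover have "(A \<union> B \<union> (edges G - inc G u)) \<inter> edges Q1 = {}"
      "(A \<union> B \<union> (edges G - inc G u) \<union> edges Q1) \<inter> edges Q2 = {}"
    using AB_sub Edisj by auto
  ultimately show ?thesis using fin finA AB(2) by (simp add: crossing_Un)
qed

lemma cut_base:
  "card (edge_boundary G T) =
     crossing_count G A T + crossing_count G B T + crossing_count G (edges G - inc G u) T"
proof -
  have "edges G = A \<union> B \<union> (edges G - inc G u)"
    unfolding AB(1) by (auto simp: inc_def)
  moreover have "card (edge_boundary G T) = crossing_count G (edges G) T"
    by (simp add: edge_boundary_def crossing_count_def)
  moreover have "(A \<union> B) \<inter> (edges G - inc G u) = {}" using AB(1) by auto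
  ultimately show ?thesis using fin finA AB(2) by (metis crossing_Un finite_Diff finite_Un)
qed

lemma cut_trivial:
  assumes "S \<inter> vertices Q1 = {} \<or> S \<inter> vertices Q1 = vertices Q1"
  shows "(p1 \<in> S) = (q1 \<in> S)" "even (card (S \<inter> vertices Q1))"
  using assms p1q1(1,2) Q1 by (auto simp: gadget_def well_cut_def)

text \<open>A cut of the new graph is compared with the cut of the old one in which the status of
  \<open>u\<close> is the parity of the part of \<open>S\<close> replacing \<open>u\<close>; this choice preserves the parity.\<close>

lemma cut_bounds:
  assumes S: "S \<subseteq> vertices G'"
  shows "odd (card S) \<Longrightarrow> r \<le> card (edge_boundary G' S)"
    and "S \<noteq> {} \<Longrightarrow> S \<noteq> vertices G' \<Longrightarrow> t \<le> card (edge_boundary G' S)"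
proof -
  define n1 where "n1 = card (S \<inter> vertices Q1)"
  define n2 where "n2 = card (S \<inter> vertices Q2)"
  define n0 where "n0 = card (S \<inter> (vertices G - {u}))"
  define s where "s \<longleftrightarrow> odd (n1 + n2 + (if h \<in> S then 1 else 0))"
  define T where "T = base_cut S s"
  have finS: "finite S" using finite_subset[OF S] multigraph by (simp add: multigraph_def)
  have cardS: "card S = n0 + n1 + n2 + (if h \<in> S then 1 else 0)"
  proof -
    have S_eq: "S = (((S \<inter> (vertices G - {u})) \<union> (S \<inter> vertices Q1)) \<union> (S \<inter> vertices Q2)) \<union> (S \<inter> {h})"
      using S V' by blast
    have "card S = card (((S \<inter> (vertices G - {u})) \<union> (S \<inter> vertices Q1)) \<union> (S \<inter> vertices Q2)) + card (S \<inter> {h})"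
      by (subst S_eq, rule card_Un_disjoint) (use finS h in auto)
    also have "card (((S \<inter> (vertices G - {u})) \<union> (S \<inter> vertices Q1)) \<union> (S \<inter> vertices Q2)) =
        card ((S \<inter> (vertices G - {u})) \<union> (S \<inter> vertices Q1)) + n2"
      unfolding n2_def by (rule card_Un_disjoint) (use finS Vdisj in auto)
    also have "card ((S \<inter> (vertices G - {u})) \<union> (S \<inter> vertices Q1)) = n0 + n1"
      unfolding n0_def n1_def by (rule card_Un_disjoint) (use finS Vdisj in auto)
    finally show ?thesis by simp
  qed
  have cardT: "card T = n0 + (if s then 1 else 0)"
    unfolding T_def base_cut_def n0_def using finS by auto
  have Tsub: "T \<subseteq> vertices G" using u by (auto simp: T_def base_cut_def)
  have par: "even (card S) = even (card T)" unfolding cardS cardT by (auto simp: s_def)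
  have evG: "even (card (vertices G))" using G by (simp add: well_cut_def)
  define c1 where "c1 = card (edge_boundary Q1 (S \<inter> vertices Q1))"
  define c2 where "c2 = card (edge_boundary Q2 (S \<inter> vertices Q2))"
  note B_eqs = fork.crossing_A[OF swap, of S s] fork.crossing_Q1[OF swap, of S]
  note A_eqs = crossing_A[of S s] crossing_Q1[of S]
  note cuts1 = gadget_cuts[of S, folded n1_def c1_def]
  note cuts2 = fork.gadget_cuts[OF swap, of S, folded n2_def c2_def]
  have bd1: "odd n1 \<longrightarrow> r \<le> c1" "even n1 \<longrightarrow> (p1 \<in> S) \<noteq> (q1 \<in> S) \<longrightarrow> 2 * card A \<le> c1"
    and bd2: "odd n2 \<longrightarrow> r \<le> c2" "even n2 \<longrightarrow> (p2 \<in> S) \<noteq> (q2 \<in> S) \<longrightarrow> 2 * card B \<le> c2"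
    using cuts1(1,3) cuts2(1,3) by simp_all
  have triv1: "c1 < t \<longrightarrow> (p1 \<in> S) = (q1 \<in> S) \<and> even n1"
    using cuts1(2) cut_trivial[of S] unfolding n1_def by fastforce
  have triv2: "c2 < t \<longrightarrow> (p2 \<in> S) = (q2 \<in> S) \<and> even n2"
    using cuts2(2) fork.cut_trivial[OF swap, of S] unfolding n2_def by fastforce
  note all = A_eqs[folded T_def c1_def] B_eqs[folded T_def c2_def]
    cut_fork[of S] cut_base[of T] crossing_old[of S s, folded T_def] cardAB
  note side1 = side_cut[OF all(1,2) bd1]
  note side2 = side_cut[OF all(3,4) bd2]
  \<comment> \<open>\<open>s\<close> agrees with the status of \<open>h\<close> iff
    \<open>n1\<close> and \<open>n2\<close> have the same parity. In both cases the terms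
    \<open>r\<close> from the odd sides pay exactly for the terms \<open>card A\<close> and
    \<open>card B\<close>, since \<open>card A + card B = r\<close>.\<close>
  have main: "card (edge_boundary G T) \<le> card (edge_boundary G' S)"
  proof (cases "s = (h \<in> S)")
    case True
    then have "even n1 = even n2" by (auto simp: s_def)
    then show ?thesis using side1(1,3) side2(1,3) True all(5-) by (cases "even n1") simp_all
  next
    case False
    then have "even n1 \<noteq> even n2" by (auto simp: s_def)
    then show ?thesis using side1(2,4) side2(2,4) False all(5-) by (cases "even n1") simp_all
  qed
  { assume "odd (card S)"
    then have "r \<le> card (edge_boundary G T)" using par Tsub G by (simp add: well_cut_def r_graph_def)
    with main show "r \<le> card (edge_boundary G' S)" by simp }
  assume nontriv: "S \<noteq> {}" "S \<noteq> vertices G'"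
  show "t \<le> card (edge_boundary G' S)"
  proof (cases "T = {} \<or> T = vertices G")
    case False
    then have "t \<le> card (edge_boundary G T)" using Tsub G by (simp add: well_cut_def)
    with main show ?thesis by simp
  next
    case True
    then have "S \<inter> (vertices G - {u}) = (if s then vertices G - {u} else {})"
      using u unfolding T_def base_cut_def by (auto split: if_splits)
    note trivs = crossing_A_trivial[OF this] fork.crossing_A_trivial[OF swap this]
    note side1 = side_cut_trivial[OF trivs(1) all(2) bd1 triv1 tA]
    note side2 = side_cut_trivial[OF trivs(2) all(4) bd2 triv2 tB]
    show ?thesis
    proof (cases "s = (h \<in> S)")
      case True
      \<comment> \<open>Otherwise \<open>S\<close> would contain all or nothing of each gadget, in
        agreement with \<open>h\<close> and the old vertices, and so be trivial itself.\<close>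
      have "\<not> (c1 < t \<and> (p1 \<in> S) = s \<and> c2 < t \<and> (p2 \<in> S) = s)"
      proof
        assume a: "c1 < t \<and> (p1 \<in> S) = s \<and> c2 < t \<and> (p2 \<in> S) = s"
        have "S \<inter> vertices Q1 = (if s then vertices Q1 else {})"
          using a cuts1(2) p1q1(1) by (metis Int_iff c1_def empty_iff not_le)
        moreover have "S \<inter> vertices Q2 = (if s then vertices Q2 else {})"
          using a cuts2(2) p2q2(1) by (metis Int_iff c2_def empty_iff not_le)
        ultimately show False using nontriv S V' True \<open>S \<inter> (vertices G - {u}) = _\<close> by (cases s) auto
      qed
      then show ?thesis using side1(1) side2(1) True all(5) by auto
    next
      case False
      then have "even n1 \<noteq> even n2" by (auto simp: s_def)
      then show ?thesis using side1(2,3) side2(2,3) False all(5) cardAB tA tB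
        by (cases "even n1") auto
    qed
  qed
qed

lemma well_cut_fork: "well_cut r t G'"
proof -
  have "even (card (vertices G'))" "1 < card (vertices G')"
    using card_vertices G Q1 Q2 by (auto simp: gadget_def well_cut_def)
  then show ?thesis
    using multigraph regular cut_bounds by (simp add: well_cut_def r_graph_def)
qed

end

section \<open>Weighted Petersen graphs\<close>

text \<open>One edge of the Petersen graph and \<open>x a\<close> copies of it for each perfect matching \<open>a\<close> containing it.\<close>

definition weight :: "(nat \<Rightarrow> nat) \<Rightarrow> nat \<Rightarrow> nat" where
  "weight x c = 1 + x (fst (pairs ! c)) + x (snd (pairs ! c))"

definition in_pair :: "nat \<Rightarrow> nat \<Rightarrow> bool" where
  "in_pair a c \<longleftrightarrow> fst (pairs ! c) = a \<or> snd (pairs ! c) = a"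

text \<open>The \<open>i\<close>-th parallel edge of class \<open>c\<close> is \<open>d + 15 * i + c\<close>; the offsets \<open>b\<close> and \<open>d\<close> serve to make
  copies disjoint from a given graph.\<close>

definition petersen :: "nat \<Rightarrow> nat \<Rightarrow> (nat \<Rightarrow> nat) \<Rightarrow> (nat, nat) mgraph" where
  "petersen b d x = \<lparr>vertices = {b..<b + 10},
     edges = {e. d \<le> e \<and> (e - d) div 15 < weight x ((e - d) mod 15)},
     ends = (\<lambda>e. {b + fst (pends ! ((e - d) mod 15)), b + snd (pends ! ((e - d) mod 15))})\<rparr>"

text \<open>Meant for sets \<open>M\<close> of edges of \<open>petersen b d x\<close>: below
  \<open>d\<close>, the truncated difference would put every number into class 0.\<close>

definition edge_class :: "nat \<Rightarrow> nat \<Rightarrow> nat set \<Rightarrow> nat set" where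
  "edge_class d c M = {e \<in> M. (e - d) mod 15 = c}"

lemma pairs_pends_bounds:
  "c < 15 \<Longrightarrow> fst (pairs ! c) < 6 \<and> snd (pairs ! c) < 6 \<and> fst (pairs ! c) \<noteq> snd (pairs ! c) \<and>
    fst (pends ! c) < 10 \<and> snd (pends ! c) < 10 \<and> fst (pends ! c) \<noteq> snd (pends ! c)"
proof -
  have "\<forall>c\<in>{..<15}. fst (pairs ! c) < 6 \<and> snd (pairs ! c) < 6 \<and> fst (pairs ! c) \<noteq> snd (pairs ! c) \<and>
    fst (pends ! c) < 10 \<and> snd (pends ! c) < 10 \<and> fst (pends ! c) \<noteq> snd (pends ! c)"
    by code_simp
  then show "c < 15 \<Longrightarrow> ?thesis" by simp
qed

lemma edges_petersen:
  "edges (petersen b d x) = (\<Union>c<15. (\<lambda>i. d + 15 * i + c) ` {..<weight x c})"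
proof (intro set_eqI iffI)
  fix e assume "e \<in> edges (petersen b d x)"
  then have e: "d \<le> e" "(e - d) div 15 < weight x ((e - d) mod 15)" by (auto simp: petersen_def)
  have "e = d + 15 * ((e - d) div 15) + (e - d) mod 15" using e(1) by simp
  then show "e \<in> (\<Union>c<15. (\<lambda>i. d + 15 * i + c) ` {..<weight x c})"
    using e(2) by (metis (no_types, lifting) UN_I image_eqI lessThan_iff mod_less_divisor zero_less_numeral)
next
  fix e assume "e \<in> (\<Union>c<15. (\<lambda>i. d + 15 * i + c) ` {..<weight x c})"
  then show "e \<in> edges (petersen b d x)" by (auto simp: petersen_def)
qed

lemma edge_class_petersen:
  assumes "c < 15"
  shows "edge_class d c (edges (petersen b d x)) = (\<lambda>i. d + 15 * i + c) ` {..<weight x c}"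
  using assms unfolding edge_class_def edges_petersen by auto

lemma card_edge_class_petersen: "c < 15 \<Longrightarrow> card (edge_class d c (edges (petersen b d x))) = weight x c"
  by (simp add: edge_class_petersen card_image inj_on_def)

lemma finite_petersen: "finite (edges (petersen b d x))"
  unfolding edges_petersen by auto

lemma card_by_edge_class:
  assumes "finite M"
  shows "card {e \<in> M. \<Phi> ((e - d) mod 15)} = (\<Sum>c<15. if \<Phi> c then card (edge_class d c M) else 0)"
proof -
  have "{e \<in> M. \<Phi> ((e - d) mod 15)} = (\<Union>c\<in>{c \<in> {..<15}. \<Phi> c}. edge_class d c M)"
    by (auto simp: edge_class_def)
  moreover have "card (\<Union>c\<in>{c \<in> {..<15}. \<Phi> c}. edge_class d c M) =
      (\<Sum>c\<in>{c \<in> {..<15}. \<Phi> c}. card (edge_class d c M))"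
    using assms by (intro card_UN_disjoint) (auto simp: edge_class_def)
  moreover have "\<dots> = (\<Sum>c<15. if \<Phi> c then card (edge_class d c M) else 0)"
    by (rule sum.inter_filter) simp
  ultimately show ?thesis by simp
qed

lemma multigraph_petersen: "multigraph (petersen b d x)"
proof -
  have "ends (petersen b d x) e \<subseteq> vertices (petersen b d x) \<and> card (ends (petersen b d x) e) = 2" for e
    using pairs_pends_bounds[of "(e - d) mod 15"] by (simp add: petersen_def)
  then show ?thesis using finite_petersen by (auto simp: multigraph_def petersen_def)
qed

lemma inc_petersen:
  assumes "M \<subseteq> edges (petersen b d x)"
  shows "card (M \<inter> inc (petersen b d x) (b + v)) =
    (\<Sum>c<15. if fst (pends ! c) = v \<or> snd (pends ! c) = v then card (edge_class d c M) else 0)"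
proof -
  have "M \<inter> inc (petersen b d x) (b + v) =
      {e \<in> M. fst (pends ! ((e - d) mod 15)) = v \<or> snd (pends ! ((e - d) mod 15)) = v}"
    using assms by (auto simp: inc_def petersen_def)
  then show ?thesis
    using card_by_edge_class[of M "\<lambda>c. fst (pends ! c) = v \<or> snd (pends ! c) = v" d]
      finite_subset[OF assms finite_petersen] by simp
qed

lemma boundary_petersen:
  "card (edge_boundary (petersen b d x) S) =
    (\<Sum>c<15. if (b + fst (pends ! c) \<in> S) \<noteq> (b + snd (pends ! c) \<in> S) then weight x c else 0)"
proof -
  have "card (ends (petersen b d x) e \<inter> S) = 1 \<longleftrightarrow>
      (b + fst (pends ! ((e - d) mod 15)) \<in> S) \<noteq> (b + snd (pends ! ((e - d) mod 15)) \<in> S)" for e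
    using pairs_pends_bounds[of "(e - d) mod 15"] by (simp add: petersen_def card_pair_Int_eq_1[simplified])
  then have "edge_boundary (petersen b d x) S = {e \<in> edges (petersen b d x).
      (b + fst (pends ! ((e - d) mod 15)) \<in> S) \<noteq> (b + snd (pends ! ((e - d) mod 15)) \<in> S)}"
    by (simp add: edge_boundary_def)
  then have "card (edge_boundary (petersen b d x) S) =
    (\<Sum>c<15. if (b + fst (pends ! c) \<in> S) \<noteq> (b + snd (pends ! c) \<in> S)
      then card (edge_class d c (edges (petersen b d x))) else 0)"
    using card_by_edge_class[of "edges (petersen b d x)"
      "\<lambda>c. (b + fst (pends ! c) \<in> S) \<noteq> (b + snd (pends ! c) \<in> S)" d, OF finite_petersen] by simp
  also have "\<dots> = (\<Sum>c<15. if (b + fst (pends ! c) \<in> S) \<noteq> (b + snd (pends ! c) \<in> S) then weight x c else 0)"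
    by (intro sum.cong) (auto simp: card_edge_class_petersen)
  finally show ?thesis .
qed

lemma lessThan_15: "{..<15::nat} = {0,1,2,3,4,5,6,7,8,9,10,11,12,13,14}"
  by (simp add: lessThan_Suc numeral_eq_Suc insert_commute)

lemma lessThan_6: "{..<6::nat} = {0,1,2,3,4,5}"
  by (simp add: lessThan_Suc numeral_eq_Suc insert_commute)

lemma lessThan_10: "{..<10::nat} = {0,1,2,3,4,5,6,7,8,9}"
  by (simp add: lessThan_Suc numeral_eq_Suc insert_commute)

lemma pends_nth:
  "pends ! 0 = (0,1)" "pends ! Suc 0 = (2,3)" "pends ! 2 = (4,5)" "pends ! 3 = (6,7)" "pends ! 4 = (8,9)"
  "pends ! 5 = (4,6)" "pends ! 6 = (2,8)" "pends ! 7 = (5,9)" "pends ! 8 = (3,7)" "pends ! 9 = (7,9)"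
  "pends ! 10 = (0,8)" "pends ! 11 = (1,5)" "pends ! 12 = (1,3)" "pends ! 13 = (0,6)" "pends ! 14 = (2,4)"
  by (simp_all add: pends_def)

lemma pairs_nth:
  "pairs ! 0 = (0,1)" "pairs ! Suc 0 = (0,2)" "pairs ! 2 = (0,3)" "pairs ! 3 = (0,4)" "pairs ! 4 = (0,5)"
  "pairs ! 5 = (1,2)" "pairs ! 6 = (1,3)" "pairs ! 7 = (1,4)" "pairs ! 8 = (1,5)" "pairs ! 9 = (2,3)"
  "pairs ! 10 = (2,4)" "pairs ! 11 = (2,5)" "pairs ! 12 = (3,4)" "pairs ! 13 = (3,5)" "pairs ! 14 = (4,5)"
  by (simp_all add: pairs_def)

text \<open>Each of the six perfect matchings uses exactly one of the three edges at a vertex of the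
  Petersen graph, so the pairs of these edges partition the six indices. The three weights therefore
  add up to 3 plus the sum of all \<open>x a\<close>.\<close>

lemma regular_petersen:
  assumes "(\<Sum>a<6. x a) + 3 = r"
  shows "regular r (petersen b d x)"
proof -
  have "degree (petersen b d x) w = r" if "w \<in> vertices (petersen b d x)" for w
  proof -
    obtain v where v: "w = b + v" "v < 10"
      using \<open>w \<in> _\<close> by (auto simp: petersen_def le_iff_add)
    have "degree (petersen b d x) w = card (edges (petersen b d x) \<inter> inc (petersen b d x) (b + v))"
      unfolding v degree_def by (rule arg_cong[where f = card]) (auto simp: inc_def)
    also have "\<dots> = (\<Sum>c<15. if fst (pends ! c) = v \<or> snd (pends ! c) = v then weight x c else 0)"
      unfolding inc_petersen[OF order_refl] by (intro sum.cong) (auto simp: card_edge_class_petersen)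
    also have "\<dots> = r"
    proof -
      have "v \<in> {..<10}" using v by simp
      then show ?thesis
        unfolding lessThan_10 using assms
        by (auto simp: lessThan_15 lessThan_6 pends_nth pairs_nth weight_def)
    qed
    finally show ?thesis .
  qed
  then show ?thesis by (simp add: regular_def)
qed

section \<open>Perfect matchings of weighted Petersen graphs\<close>

text \<open>Forgetting which parallel edge is used turns \<open>M\<close> into a perfect matching of
  the Petersen graph, described by its class counts.\<close>

lemma matching_petersen:
  assumes "perfect_matching (petersen b d x) M"
  shows "\<exists>a<6. \<forall>c<15. card (edge_class d c M) = (if in_pair a c then 1 else 0)"
proof -
  define y where "y c = card (edge_class d c M)" for c
  have M: "M \<subseteq> edges (petersen b d x)" using assms by (simp add: perfect_matching_def)
  have eq: "(\<Sum>c<15. if fst (pends ! c) = v \<or> snd (pends ! c) = v then y c else 0) = 1" if "v < 10" for v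
  proof -
    have "b + v \<in> vertices (petersen b d x)" using that by (simp add: petersen_def)
    then have "card (M \<inter> inc (petersen b d x) (b + v)) = 1"
      using assms by (simp add: perfect_matching_def)
    then show ?thesis unfolding inc_petersen[OF M] y_def .
  qed
  note eqs = eq[of 0] eq[of 1] eq[of 2] eq[of 3] eq[of 4] eq[of 5] eq[of 6] eq[of 7] eq[of 8] eq[of 9]
  \<comment> \<open>The ten vertex equations in the 15 unknowns \<open>y c\<close> have only the six
    known perfect matchings as solutions in natural numbers.\<close>
  have "\<exists>a\<in>{..<6}. \<forall>c\<in>{..<15}. y c = (if in_pair a c then 1 else 0)"
    using eqs unfolding in_pair_def lessThan_15 lessThan_6
    apply (simp add: pends_nth pairs_nth)
    apply (smt (verit) add_is_1 add_is_0 One_nat_def)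
    done
  then show ?thesis unfolding y_def by auto
qed

section \<open>Cuts of weighted Petersen graphs\<close>

text \<open>Exchange of summation. The entries of a pair have to differ, as \<open>mult\<close>
  would count a pair \<open>(a, a)\<close> only once.\<close>

lemma crossed_sum:
  assumes "\<forall>(i, j)\<in>set ps. i < 6 \<and> j < 6 \<and> i \<noteq> j"
  shows "(\<Sum>(i, j)\<leftarrow>ps. 1 + x i + x j) = length ps + (\<Sum>a<6. x a * mult ps a)"
  using assms
proof (induction ps)
  case Nil then show ?case by (simp add: mult_def)
next
  case (Cons p ps)
  obtain i j where p: "p = (i, j)" "i < 6" "j < 6" "i \<noteq> j" using Cons.prems by (cases p) auto
  have "mult (p # ps) a = mult ps a + ((if a = i then 1 else 0) + (if a = j then 1 else 0))" for a
    using p by (auto simp: mult_def)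
  then have "(\<Sum>a<6. x a * mult (p # ps) a) = (\<Sum>a<6. x a * mult ps a) +
      ((\<Sum>a<6. x a * (if a = i then 1 else 0)) + (\<Sum>a<6. x a * (if a = j then 1 else 0)))"
    by (simp only: distrib_left sum.distrib)
  also have "(\<Sum>a<6. x a * (if a = i then 1 else 0)) = x i" using p by (simp add: if_distrib cong: if_cong)
  also have "(\<Sum>a<6. x a * (if a = j then 1 else 0)) = x j" using p by (simp add: if_distrib cong: if_cong)
  finally show ?case using Cons p by simp
qed

lemma set_pairs: "set pairs = (\<lambda>c. pairs ! c) ` {..<15}"
proof -
  have "length pairs = 15" by (simp add: pairs_def)
  then show ?thesis by (metis atLeast_upt list.set_map map_nth)
qed

lemma pair_bounds: "(i, j) \<in> set pairs \<Longrightarrow> i < 6 \<and> j < 6 \<and> i \<noteq> j"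
proof -
  assume "(i, j) \<in> set pairs"
  then obtain c where "c < 15" "pairs ! c = (i, j)" unfolding set_pairs by auto
  then show ?thesis using pairs_pends_bounds[of c] by simp
qed

definition indicator_list :: "nat \<Rightarrow> nat set \<Rightarrow> bool list" where
  "indicator_list b S = map (\<lambda>v. b + v \<in> S) [0..<10]"

lemma crossed_indicator_list:
  "crossed (indicator_list b S) =
    map (\<lambda>c. pairs ! c) (filter (\<lambda>c. (b + fst (pends ! c) \<in> S) \<noteq> (b + snd (pends ! c) \<in> S)) [0..<15])"
proof -
  have "zip pends pairs = map (\<lambda>c. (pends ! c, pairs ! c)) [0..<15]"
  proof -
    have "length pends = 15" "length pairs = 15" by (simp_all add: pends_def pairs_def)
    then show ?thesis by (intro nth_equalityI) simp_all
  qed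
  moreover have "filter (\<lambda>c. (indicator_list b S ! fst (pends ! c)) \<noteq> (indicator_list b S ! snd (pends ! c))) [0..<15] =
      filter (\<lambda>c. (b + fst (pends ! c) \<in> S) \<noteq> (b + snd (pends ! c) \<in> S)) [0..<15]"
    using pairs_pends_bounds by (intro filter_cong) (auto simp: indicator_list_def)
  ultimately show ?thesis
    by (simp add: crossed_def filter_map o_def case_prod_beta)
qed

lemma set_crossed: "set (crossed (indicator_list b S)) =
    (\<lambda>c. pairs ! c) ` {c. c < 15 \<and> (b + fst (pends ! c) \<in> S) \<noteq> (b + snd (pends ! c) \<in> S)}"
  unfolding crossed_indicator_list by auto

text \<open>The graph is the Petersen graph plus \<open>x a\<close> copies of the perfect matching
  \<open>a\<close> for every \<open>a\<close>, and its cuts add up accordingly.\<close>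

lemma boundary_petersen_mult:
  defines "ps \<equiv> \<lambda>b S. crossed (indicator_list b S)"
  shows "card (edge_boundary (petersen b d x) S) = length (ps b S) + (\<Sum>a<6. x a * mult (ps b S) a)"
proof -
  have "card (edge_boundary (petersen b d x) S) =
      (\<Sum>c\<leftarrow>[0..<15]. if (b + fst (pends ! c) \<in> S) \<noteq> (b + snd (pends ! c) \<in> S) then weight x c else 0)"
    unfolding boundary_petersen by (simp add: interv_sum_list_conv_sum_set_nat atLeast0LessThan)
  also have "\<dots> = (\<Sum>(i, j)\<leftarrow>ps b S. 1 + x i + x j)"
    unfolding ps_def crossed_indicator_list
    by (simp add: sum_list_map_filter' o_def case_prod_beta weight_def cong: if_cong)
  also have "\<dots> = length (ps b S) + (\<Sum>a<6. x a * mult (ps b S) a)"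
    using pairs_pends_bounds by (intro crossed_sum) (auto simp: ps_def set_crossed case_prod_beta)
  finally show ?thesis .
qed

lemma length_indicator_list:
  assumes "S \<subseteq> {b..<b + 10}"
  shows "length (filter id (indicator_list b S)) = card S"
proof -
  have "length (filter id (indicator_list b S)) = length (filter (\<lambda>v. b + v \<in> S) [0..<10])"
    by (simp add: indicator_list_def filter_map o_def id_def)
  also have "\<dots> = card {v. v < 10 \<and> b + v \<in> S}"
    by (subst distinct_card[symmetric]) (auto intro: arg_cong[where f = card])
  also have "\<dots> = card ((+) b ` {v. v < 10 \<and> b + v \<in> S})"
    by (simp add: card_image)
  also have "(+) b ` {v. v < 10 \<and> b + v \<in> S} = S"
  proof (intro set_eqI iffI)
    fix w assume "w \<in> S"
    then obtain v where "w = b + v" "v < 10" using assms by (auto simp: le_iff_add subset_iff)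
    with \<open>w \<in> S\<close> show "w \<in> (+) b ` {v. v < 10 \<and> b + v \<in> S}" by auto
  qed auto
  finally show ?thesis .
qed

lemma cut_check_indicator_list: "cut_check (indicator_list b S)"
proof -
  have "indicator_list b S \<in> set (List.n_lists 10 [False, True])"
    by (auto simp: indicator_list_def set_n_lists)
  then show ?thesis using cut_check by (simp add: list_all_iff)
qed

text \<open>The Petersen graph is connected: agreement along its 15 edges spreads to all ten
  vertices.\<close>

lemma crossed_Nil:
  assumes "crossed (indicator_list b S) = []" "S \<subseteq> {b..<b + 10}"
  shows "S = {} \<or> S = {b..<b + 10}"
proof -
  have "set (crossed (indicator_list b S)) = {}" using assms by simp
  then have "\<forall>c\<in>{..<15}. (b + fst (pends ! c) \<in> S) = (b + snd (pends ! c) \<in> S)"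
    unfolding set_crossed by auto
  then have const: "\<forall>v\<in>{..<10}. b + v \<in> S \<longleftrightarrow> b \<in> S"
    unfolding lessThan_15 lessThan_10 by (simp add: pends_nth)
  have "w \<in> S \<longleftrightarrow> b \<in> S" if w: "w \<in> {b..<b + 10}" for w
  proof -
    obtain v where "w = b + v" "v < 10" using w by (auto simp: le_iff_add)
    then show ?thesis using const by auto
  qed
  then show ?thesis using assms(2) by blast
qed

text \<open>An odd cut has 3 edges of the Petersen graph and meets every matching, hence has at
  least \<open>r\<close> edges. A nontrivial even cut has 4 such edges and meets all but two
  matchings \<open>i\<close>, \<open>j\<close> twice, which leaves at least
  \<open>2 * r - 2 * weight x c\<close> edges for the class \<open>c\<close> of the pair
  \<open>(i, j)\<close>. If class \<open>c\<close> itself crosses an even cut, both of its matchings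
  do so twice.\<close>

lemma petersen_cuts:
  assumes x: "(\<Sum>a<6. x a) + 3 = r" and S: "S \<subseteq> {b..<b + 10}"
  shows "odd (card S) \<Longrightarrow> r \<le> card (edge_boundary (petersen b d x) S)"
    and "even (card S) \<Longrightarrow> S \<noteq> {} \<Longrightarrow> S \<noteq> {b..<b + 10} \<Longrightarrow>
      \<exists>c<15. 2 * r \<le> card (edge_boundary (petersen b d x) S) + 2 * weight x c"
    and "even (card S) \<Longrightarrow> c < 15 \<Longrightarrow> (b + fst (pends ! c) \<in> S) \<noteq> (b + snd (pends ! c) \<in> S) \<Longrightarrow>
      2 * weight x c \<le> card (edge_boundary (petersen b d x) S)"
proof -
  define ps where "ps = crossed (indicator_list b S)"
  have chk: "if odd (card S) then length ps \<ge> 3 \<and> (\<forall>a<6. mult ps a \<ge> 1)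
     else ps = [] \<or> (length ps \<ge> 4 \<and> (\<exists>(i,j)\<in>set pairs. \<forall>a<6. mult ps a \<ge> 2 \<or> a = i \<or> a = j)
       \<and> (\<forall>(i,j)\<in>set ps. mult ps i \<ge> 2 \<and> mult ps j \<ge> 2))"
  proof -
    have "set [0..<6] = {..<6::nat}" by auto
    then show ?thesis
      using cut_check_indicator_list[of b S] length_indicator_list[OF S]
      unfolding cut_check_def Let_def ps_def list_all_iff list_ex_iff
      by (cases "odd (card S)") (simp_all add: case_prod_beta Ball_def)
  qed
  have cut: "card (edge_boundary (petersen b d x) S) = length ps + (\<Sum>a<6. x a * mult ps a)"
    unfolding ps_def by (rule boundary_petersen_mult)
  { assume "odd (card S)"
    with chk have "length ps \<ge> 3" "\<And>a. a < 6 \<Longrightarrow> mult ps a \<ge> 1" by auto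
    moreover from this have "(\<Sum>a<6. x a) \<le> (\<Sum>a<6. x a * mult ps a)"
      by (intro sum_mono) (simp add: Suc_le_eq)
    ultimately show "r \<le> card (edge_boundary (petersen b d x) S)" using cut x by linarith }
  { assume "even (card S)" "S \<noteq> {}" "S \<noteq> {b..<b + 10}"
    then have "ps \<noteq> []" using crossed_Nil[OF _ S] by (auto simp: ps_def)
    with chk \<open>even (card S)\<close> obtain i j where l: "length ps \<ge> 4" and ij: "(i, j) \<in> set pairs"
      and m: "\<And>a. a < 6 \<Longrightarrow> mult ps a \<ge> 2 \<or> a = i \<or> a = j" by auto
    obtain c where c: "c < 15" "pairs ! c = (i, j)" using ij unfolding set_pairs by auto
    have b: "i < 6" "j < 6" "i \<noteq> j" using pair_bounds[OF ij] by auto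
    \<comment> \<open>Adding \<open>2 * x i\<close> and \<open>2 * x j\<close> for the two
      exceptional matchings makes the comparison hold term by term.\<close>
    have "(\<Sum>a<6. 2 * x a) \<le> (\<Sum>a<6. x a * mult ps a + ((if a = i then 2 * x a else 0) + (if a = j then 2 * x a else 0)))"
    proof (rule sum_mono)
      fix a :: nat assume "a \<in> {..<6}"
      then consider "mult ps a \<ge> 2" | "a = i" | "a = j" using m by auto
      then show "2 * x a \<le> x a * mult ps a + ((if a = i then 2 * x a else 0) + (if a = j then 2 * x a else 0))"
      proof cases
        case 1
        then have "x a * 2 \<le> x a * mult ps a" by (rule mult_left_mono) simp
        then show ?thesis by linarith
      qed auto
    qed
    also have "\<dots> = (\<Sum>a<6. x a * mult ps a) + (2 * x i + 2 * x j)"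
      using b by (simp add: sum.distrib)
    finally have "2 * (\<Sum>a<6. x a) \<le> (\<Sum>a<6. x a * mult ps a) + (2 * x i + 2 * x j)"
      by (simp add: sum_distrib_left)
    then have "2 * r \<le> card (edge_boundary (petersen b d x) S) + 2 * weight x c"
      using cut x l c by (simp add: weight_def)
    then show "\<exists>c<15. 2 * r \<le> card (edge_boundary (petersen b d x) S) + 2 * weight x c"
      using c by auto }
  { assume ev: "even (card S)" and c: "c < 15" and cr: "(b + fst (pends ! c) \<in> S) \<noteq> (b + snd (pends ! c) \<in> S)"
    obtain i j where ij: "pairs ! c = (i, j)" by fastforce
    have mem: "(i, j) \<in> set ps" unfolding ps_def set_crossed using c cr ij[symmetric] by simp
    then have l: "length ps \<ge> 4" "mult ps i \<ge> 2" "mult ps j \<ge> 2" using chk ev by auto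
    have b: "i < 6" "j < 6" "i \<noteq> j" using pairs_pends_bounds[OF c] ij by auto
    have "2 * x i + 2 * x j \<le> x i * mult ps i + x j * mult ps j"
      using mult_le_mono2[OF l(2), of "x i"] mult_le_mono2[OF l(3), of "x j"] by linarith
    also have "\<dots> = (\<Sum>a\<in>{i, j}. x a * mult ps a)" using b by simp
    also have "\<dots> \<le> (\<Sum>a<6. x a * mult ps a)" by (rule sum_mono2) (use b in auto)
    finally show "2 * weight x c \<le> card (edge_boundary (petersen b d x) S)"
      using cut l ij by (simp add: weight_def) }
qed

text \<open>By the even case of \<open>petersen_cuts\<close>, class sizes of at most
  \<open>r - t/2\<close> force nontrivial even cuts to have at least \<open>t\<close> edges.\<close>

lemma well_cut_petersen:
  assumes x: "(\<Sum>a<6. x a) + 3 = r" and t: "t \<le> r" and w: "\<forall>c<15. t + 2 * weight x c \<le> 2 * r"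
  shows "well_cut r t (petersen b d x)"
proof -
  have V: "vertices (petersen b d x) = {b..<b + 10}" by (simp add: petersen_def)
  have "t \<le> card (edge_boundary (petersen b d x) S)"
    if S: "S \<subseteq> {b..<b + 10}" "S \<noteq> {}" "S \<noteq> {b..<b + 10}" for S
  proof (cases "even (card S)")
    case True
    then obtain c where "c < 15" "2 * r \<le> card (edge_boundary (petersen b d x) S) + 2 * weight x c"
      using petersen_cuts(2)[OF x S(1)] S by blast
    with w show ?thesis by fastforce
  next
    case False
    then show ?thesis using petersen_cuts(1)[OF x S(1)] t order_trans by blast
  qed
  then show ?thesis
    using petersen_cuts(1)[OF x] multigraph_petersen regular_petersen[OF x] V
    by (simp add: well_cut_def r_graph_def)
qed

lemma gadget_petersen:
  assumes x: "(\<Sum>a<6. x a) + 3 = r" and t: "t \<le> r" and w: "\<forall>c<15. t + 2 * weight x c \<le> 2 * r" and c: "c < 15"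
  shows "gadget r t (petersen b d x) (b + fst (pends ! c)) (b + snd (pends ! c))
    (edge_class d c (edges (petersen b d x)))"
  unfolding gadget_def card_edge_class_petersen[OF c]
  using well_cut_petersen[OF x t w] petersen_cuts(3)[OF x] pairs_pends_bounds[OF c] c
  by (auto simp: petersen_def edge_class_def)

section \<open>Disjoint families of perfect matchings in weighted Petersen graphs\<close>

text \<open>The differences \<open>n a - x a\<close> have sum 1 and pairwise sums at most 1, hence form a unit vector.\<close>

lemma unit_vector:
  fixes n x :: "nat \<Rightarrow> nat"
  assumes "(\<Sum>a<6. n a) = (\<Sum>a<6. x a) + 1" and "\<forall>c<15. n (fst (pairs ! c)) + n (snd (pairs ! c)) \<le> weight x c"
  shows "\<exists>j<6. \<forall>a<6. n a = x a + (if a = j then 1 else 0)"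
proof -
  have sums: "n 0 + n 1 + n 2 + n 3 + n 4 + n 5 = x 0 + x 1 + x 2 + x 3 + x 4 + x 5 + 1"
    using assms(1) by (simp add: lessThan_6)
  have "\<forall>c\<in>{..<15}. n (fst (pairs ! c)) + n (snd (pairs ! c)) \<le> weight x c" using assms(2) by simp
  then have le: "n 0 + n 1 \<le> 1 + x 0 + x 1" "n 0 + n 2 \<le> 1 + x 0 + x 2" "n 0 + n 3 \<le> 1 + x 0 + x 3"
    "n 0 + n 4 \<le> 1 + x 0 + x 4" "n 0 + n 5 \<le> 1 + x 0 + x 5" "n 1 + n 2 \<le> 1 + x 1 + x 2"
    "n 1 + n 3 \<le> 1 + x 1 + x 3" "n 1 + n 4 \<le> 1 + x 1 + x 4" "n 1 + n 5 \<le> 1 + x 1 + x 5"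
    "n 2 + n 3 \<le> 1 + x 2 + x 3" "n 2 + n 4 \<le> 1 + x 2 + x 4" "n 2 + n 5 \<le> 1 + x 2 + x 5"
    "n 3 + n 4 \<le> 1 + x 3 + x 4" "n 3 + n 5 \<le> 1 + x 3 + x 5" "n 4 + n 5 \<le> 1 + x 4 + x 5"
    unfolding lessThan_15 by (simp_all add: pairs_nth weight_def)
  have "\<exists>j\<in>{..<6}. x j < n j"
  proof (rule ccontr)
    assume "\<not> ?thesis"
    then have "(\<Sum>a<6. n a) \<le> (\<Sum>a<6. x a)" by (intro sum_mono) (simp add: not_less)
    with assms(1) show False by simp
  qed
  then obtain j where j: "j \<in> {0, 1, 2, 3, 4, 5}" "x j < n j" unfolding lessThan_6 by blast
  \<comment> \<open>The argument with the distinguished index in front, to be instantiated for each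
    \<open>j\<close>: an excess at \<open>j\<close> forbids an excess elsewhere, and then the total
    leaves room only for an excess of 1 at \<open>j\<close> and equality elsewhere.\<close>
  have solve: "m0 = y0 + 1 \<and> m1 = y1 \<and> m2 = y2 \<and> m3 = y3 \<and> m4 = y4 \<and> m5 = y5"
    if "m0 + m1 + m2 + m3 + m4 + m5 = y0 + y1 + y2 + y3 + y4 + y5 + 1" "y0 < m0"
      "m0 + m1 \<le> 1 + y0 + y1" "m0 + m2 \<le> 1 + y0 + y2" "m0 + m3 \<le> 1 + y0 + y3"
      "m0 + m4 \<le> 1 + y0 + y4" "m0 + m5 \<le> 1 + y0 + y5"
    for m0 m1 m2 m3 m4 m5 y0 y1 y2 y3 y4 y5 :: nat
  proof -
    have "m1 \<le> y1" "m2 \<le> y2" "m3 \<le> y3" "m4 \<le> y4" "m5 \<le> y5" using that(2-) by linarith+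
    moreover have "m0 \<le> y0 + 1" using that by linarith
    ultimately show ?thesis using that(1) by linarith
  qed
  have "\<forall>a\<in>{..<6}. n a = x a + (if a = j then 1 else 0)"
  proof -
    from j(1) consider "j = 0" | "j = 1" | "j = 2" | "j = 3" | "j = 4" | "j = 5" by blast
    then show ?thesis
    proof cases
      case 1 then show ?thesis
        using solve[of "n 0" "n 1" "n 2" "n 3" "n 4" "n 5" "x 0" "x 1" "x 2" "x 3" "x 4" "x 5"] j(2) sums le(1,2,3,4,5)
        unfolding lessThan_6 by simp
    next
      case 2 then show ?thesis
        using solve[of "n 1" "n 0" "n 2" "n 3" "n 4" "n 5" "x 1" "x 0" "x 2" "x 3" "x 4" "x 5"] j(2) sums le(1,6,7,8,9)
        unfolding lessThan_6 by simp
    next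
      case 3 then show ?thesis
        using solve[of "n 2" "n 0" "n 1" "n 3" "n 4" "n 5" "x 2" "x 0" "x 1" "x 3" "x 4" "x 5"] j(2) sums le(2,6,10,11,12)
        unfolding lessThan_6 by simp
    next
      case 4 then show ?thesis
        using solve[of "n 3" "n 0" "n 1" "n 2" "n 4" "n 5" "x 3" "x 0" "x 1" "x 2" "x 4" "x 5"] j(2) sums le(3,7,10,13,14)
        unfolding lessThan_6 by simp
    next
      case 5 then show ?thesis
        using solve[of "n 4" "n 0" "n 1" "n 2" "n 3" "n 5" "x 4" "x 0" "x 1" "x 2" "x 3" "x 5"] j(2) sums le(4,8,11,13,15)
        unfolding lessThan_6 by simp
    next
      case 6 then show ?thesis
        using solve[of "n 5" "n 0" "n 1" "n 2" "n 3" "n 4" "x 5" "x 0" "x 1" "x 2" "x 3" "x 4"] j(2) sums le(5,9,12,14,15)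
        unfolding lessThan_6 by simp
    qed
  qed
  then show ?thesis using j(1) by auto
qed

text \<open>Let \<open>n a\<close> be the number of matchings of type \<open>a\<close>. Class
  \<open>c\<close> has room for \<open>weight x c\<close> of them, and \<open>r - 2\<close> exceeds
  the sum of the \<open>x a\<close> by 1, so \<open>unit_vector\<close> gives \<open>n\<close> up to
  the choice of \<open>j\<close>. What remains of a class is its weight minus the two values of
  \<open>n\<close>.\<close>

lemma matching_family_petersen:
  assumes x: "(\<Sum>a<6. x a) + 3 = r" and N: "matching_family (r - 2) (petersen b d x) N"
  shows "\<exists>j<6. \<forall>c<15. card (edge_class d c (edges (petersen b d x)) - (\<Union>i<r - 2. N i)) =
    (if in_pair j c then 0 else 1)"
proof -
  let ?E = "\<lambda>c. edge_class d c (edges (petersen b d x))"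
  have "\<forall>i. \<exists>a. i < r - 2 \<longrightarrow> a < 6 \<and> (\<forall>c<15. card (edge_class d c (N i)) = (if in_pair a c then 1 else 0))"
    using matching_petersen N unfolding matching_family_def by meson
  then obtain f where f: "\<And>i. i < r - 2 \<Longrightarrow> f i < 6"
    and fc: "\<And>i c. i < r - 2 \<Longrightarrow> c < 15 \<Longrightarrow> card (edge_class d c (N i)) = (if in_pair (f i) c then 1 else 0)"
    by metis
  have sub: "N i \<subseteq> edges (petersen b d x)" if "i < r - 2" for i
    using N that by (simp add: matching_family_def perfect_matching_def)
  define n where "n a = card {i \<in> {..<r - 2}. f i = a}" for a
  have count: "card (?E c \<inter> (\<Union>i<r - 2. N i)) = n (fst (pairs ! c)) + n (snd (pairs ! c))" if c: "c < 15" for c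
  proof -
    have "?E c \<inter> (\<Union>i<r - 2. N i) = (\<Union>i<r - 2. edge_class d c (N i))"
      using sub by (auto simp: edge_class_def)
    also have "card \<dots> = (\<Sum>i<r - 2. card (edge_class d c (N i)))"
    proof (rule card_UN_disjoint)
      show "\<forall>i\<in>{..<r - 2}. finite (edge_class d c (N i))"
        using finite_subset[OF sub finite_petersen] by (simp add: edge_class_def)
      have "N i \<inter> N j = {}" if "i < r - 2" "j < r - 2" "i \<noteq> j" for i j
        using N that by (simp add: matching_family_def)
      then show "\<forall>i\<in>{..<r - 2}. \<forall>j\<in>{..<r - 2}. i \<noteq> j \<longrightarrow> edge_class d c (N i) \<inter> edge_class d c (N j) = {}"
        unfolding edge_class_def by blast
    qed simp
    also have "\<dots> = (\<Sum>i<r - 2. if in_pair (f i) c then 1 else 0)" using fc c by simp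
    also have "\<dots> = (\<Sum>i<r - 2. (if f i = fst (pairs ! c) then 1 else 0) + (if f i = snd (pairs ! c) then 1 else 0))"
      using pairs_pends_bounds[OF c] by (intro sum.cong) (auto simp: in_pair_def)
    also have "\<dots> = n (fst (pairs ! c)) + n (snd (pairs ! c))"
      unfolding n_def sum.distrib by (simp add: sum.inter_filter[symmetric] del: mem_Collect_eq lessThan_iff)
    finally show ?thesis .
  qed
  have le: "n (fst (pairs ! c)) + n (snd (pairs ! c)) \<le> weight x c" if c: "c < 15" for c
  proof -
    have "finite (?E c)" using finite_petersen by (simp add: edge_class_def)
    then have "card (?E c \<inter> (\<Union>i<r - 2. N i)) \<le> card (?E c)" by (intro card_mono) auto
    then show ?thesis using count[OF c] card_edge_class_petersen[OF c] by simp
  qed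
  have "(\<Sum>a<6. n a) = card (\<Union>a<6. {i \<in> {..<r - 2}. f i = a})"
    unfolding n_def by (intro card_UN_disjoint[symmetric]) auto
  also have "(\<Union>a<6. {i \<in> {..<r - 2}. f i = a}) = {..<r - 2}" using f by auto
  finally have "(\<Sum>a<6. n a) = (\<Sum>a<6. x a) + 1" using x by simp
  then obtain j where j: "j < 6" "\<And>a. a < 6 \<Longrightarrow> n a = x a + (if a = j then 1 else 0)"
    using unit_vector[of n x] le by blast
  have "card (?E c - (\<Union>i<r - 2. N i)) = (if in_pair j c then 0 else 1)" if c: "c < 15" for c
  proof -
    have fin: "finite (?E c)" using finite_petersen by (simp add: edge_class_def)
    have "card (?E c - (\<Union>i<r - 2. N i)) = card (?E c) - card (?E c \<inter> (\<Union>i<r - 2. N i))"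
      using fin by (metis card_Diff_subset_Int finite_Int)
    then show ?thesis
      using count[OF c] card_edge_class_petersen[OF c] j(2)[of "fst (pairs ! c)"] j(2)[of "snd (pairs ! c)"]
        pairs_pends_bounds[OF c] by (auto simp: weight_def in_pair_def)
  qed
  then show ?thesis using j(1) by blast
qed

section \<open>Matchings after forking\<close>

definition tight :: "nat \<Rightarrow> ('v, 'e) mgraph \<Rightarrow> 'e set \<Rightarrow> bool" where
  "tight k G P \<longleftrightarrow> (\<forall>N. matching_family k G N \<longrightarrow> card (P - (\<Union>i<k. N i)) \<le> 1)"

lemma card_Int_matching_family:
  assumes "multigraph G" "matching_family k G N"
  shows "card (X \<inter> (\<Union>i<k. N i)) = (\<Sum>i<k. card (N i \<inter> X))"
proof -
  have "X \<inter> (\<Union>i<k. N i) = (\<Union>i<k. N i \<inter> X)" by auto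
  also have "card \<dots> = (\<Sum>i<k. card (N i \<inter> X))"
  proof (rule card_UN_disjoint)
    show "\<forall>i\<in>{..<k}. finite (N i \<inter> X)"
      using assms finite_subset by (fastforce simp: matching_family_def perfect_matching_def multigraph_def)
    have "N i \<inter> N j = {}" if "i < k" "j < k" "i \<noteq> j" for i j
      using assms(2) that by (simp add: matching_family_def)
    then show "\<forall>i\<in>{..<k}. \<forall>j\<in>{..<k}. i \<noteq> j \<longrightarrow> (N i \<inter> X) \<inter> (N j \<inter> X) = {}" by blast
  qed simp
  finally show ?thesis .
qed

context fork begin

lemma family_G:
  assumes "matching_family k G' N"
  shows "matching_family k G (\<lambda>i. N i \<inter> edges G)"
proof -
  have "N i \<inter> N j = {}" if "i < k" "j < k" "i \<noteq> j" for i j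
    using assms that by (simp add: matching_family_def)
  then have "\<forall>i<k. \<forall>j<k. i \<noteq> j \<longrightarrow> (N i \<inter> edges G) \<inter> (N j \<inter> edges G) = {}" by blast
  then show ?thesis using assms matching_G by (simp add: matching_family_def)
qed

lemma family_Q1:
  assumes "matching_family k G' N"
  shows "matching_family k Q1 (\<lambda>i. N i \<inter> edges Q1)"
proof -
  have "N i \<inter> N j = {}" if "i < k" "j < k" "i \<noteq> j" for i j
    using assms that by (simp add: matching_family_def)
  then have "\<forall>i<k. \<forall>j<k. i \<noteq> j \<longrightarrow> (N i \<inter> edges Q1) \<inter> (N j \<inter> edges Q1) = {}" by blast
  then show ?thesis using assms matching_Q1 by (simp add: matching_family_def)
qed

lemma unused_A_le:
  assumes N: "matching_family k G' N" and T: "tight k Q1 P1"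
  shows "card (A - (\<Union>i<k. N i)) \<le> 1"
proof -
  let ?U = "\<Union>i<k. N i"
  have "card (A \<inter> ?U) = card (P1 \<inter> ?U)"
    unfolding card_Int_matching_family[OF multigraph N]
    using card_matching_A_P1(1) N by (simp add: matching_family_def)
  moreover have "card (A - ?U) = card A - card (A \<inter> ?U)" "card (P1 - ?U) = card P1 - card (P1 \<inter> ?U)"
    using finA by (metis card_Diff_subset_Int finite_Int)+
  ultimately have "card (A - ?U) = card (P1 - ?U)" using P1 by simp
  also have "P1 - ?U = P1 - (\<Union>i<k. N i \<inter> edges Q1)" using p1q1(4) by auto
  also have "card \<dots> \<le> 1" by (rule T[unfolded tight_def, rule_format, OF family_Q1[OF N]])
  finally show ?thesis .
qed

lemma unused_A:
  assumes N: "matching_family (r - 2) G' N" and T: "tight (r - 2) Q1 P1" "tight (r - 2) Q2 P2" and r: "2 \<le> r"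
  shows "card (A - (\<Union>i<r - 2. N i)) = 1"
proof -
  let ?U = "\<Union>i<r - 2. N i"
  have "card (inc G u \<inter> ?U) = card (inc G u \<inter> (\<Union>i<r - 2. N i \<inter> edges G))"
    by (rule arg_cong[where f = card]) (auto simp: inc_def)
  also have "\<dots> = r - 2"
    unfolding card_Int_matching_family[OF mg(1) family_G[OF N]]
    using family_G[OF N] u by (simp add: matching_family_def perfect_matching_def)
  finally have "card (inc G u - ?U) = 2"
    using degs(1)[OF u] finA(6)[of u] r by (metis card_Diff_subset_Int diff_diff_cancel finite_Int)
  moreover have "inc G u - ?U = (A - ?U) \<union> (B - ?U)" using AB(1) by auto
  moreover have "card ((A - ?U) \<union> (B - ?U)) = card (A - ?U) + card (B - ?U)"
    using finA AB(2) by (intro card_Un_disjoint) auto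
  ultimately have "card (A - ?U) + card (B - ?U) = 2" by simp
  then show ?thesis
    using unused_A_le[OF N T(1)] fork.unused_A_le[OF swap N T(2)] by linarith
qed

end

section \<open>Existence of gadgets and forks\<close>

lemma tight_petersen:
  assumes "(\<Sum>a<6. x a) + 3 = r" "c < 15"
  shows "tight (r - 2) (petersen b d x) (edge_class d c (edges (petersen b d x)))"
  unfolding tight_def
proof (intro allI impI)
  fix N assume "matching_family (r - 2) (petersen b d x) N"
  from matching_family_petersen[OF assms(1) this] obtain j where
    "\<forall>c<15. card (edge_class d c (edges (petersen b d x)) - (\<Union>i<r - 2. N i)) = (if in_pair j c then 0 else 1)"
    by blast
  then show "card (edge_class d c (edges (petersen b d x)) - (\<Union>i<r - 2. N i)) \<le> 1"
    using assms(2) by simp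
qed

lemma petersen_gadget_exists:
  fixes r t w b d :: nat
  assumes t: "even t" "4 \<le> t" "t \<le> r" and w: "t \<le> 2 * w" "2 * w + t \<le> 2 * r"
  shows "\<exists>Q p q P. gadget r t Q p q P \<and> card P = w \<and> tight (r - 2) Q P \<and>
    vertices Q = {b..<b + 10} \<and> edges Q \<subseteq> {d..}"
proof -
  \<comment> \<open>\<open>w - 1\<close> copies are divided evenly between the matchings 0 and 1,
    which gives class 0 the weight \<open>w\<close>; the other \<open>r - 2 - w\<close> copies are
    divided evenly between 2 and 3. The even division keeps mixed pairs small.\<close>
  define x where "x a = (if a = 0 then w div 2 else if a = 1 then (w - 1) div 2
    else if a = 2 then (r - 1 - w) div 2 else if a = 3 then (r - 2 - w) div 2 else 0)" for a :: nat
  obtain m where m: "t = 2 * m" using t(1) by (elim evenE)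
  have w1: "2 \<le> w" "w + m \<le> r" "m \<le> w" "2 * m \<le> r" "2 \<le> m" using t w m by auto
  define k where "k = r - 2 - w"
  have k: "r = k + 2 + w" using w1(2,5) unfolding k_def by simp
  have half: "(n + 1) div 2 + n div 2 = n" for n :: nat by simp
  have s1: "w div 2 + (w - 1) div 2 + 1 = w" using half[of "w - 1"] w1(1) by simp
  have s2: "(r - 1 - w) div 2 + (r - 2 - w) div 2 + w + 2 = r" using half[of k] k by simp
  have sum: "(\<Sum>a<6. x a) + 3 = r" using s1 s2 by (simp add: lessThan_6 x_def)
  have h: "1 + w div 2 + (r - 1 - w) div 2 + m \<le> r"
  proof -
    have "2 * (w div 2) \<le> w" "2 * ((k + 1) div 2) \<le> k + 1" by simp_all
    then have "1 + w div 2 + (k + 1) div 2 + m \<le> r" using k w1(4) by linarith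
    then show ?thesis using k by simp
  qed
  have vals: "x 0 + x 1 + 1 = w" "x 2 + x 3 + w + 2 = r" "1 + x 0 + x 2 + m \<le> r" "x 1 \<le> x 0" "x 3 \<le> x 2"
    "x 4 = 0" "x 5 = 0"
    using s1 s2 h by (auto simp: x_def intro!: div_le_mono diff_le_mono2)
  \<comment> \<open>The pair 0, 1 is bounded by the upper bound on \<open>w\<close>, the pair 2, 3
    by the lower one, and the pair 0, 2 by \<open>h\<close>; the latter dominates all
    others.\<close>
  have le: "1 + x i + x j + m \<le> r" if "i < j" "j < 6" for i j
  proof -
    have "i \<in> {..<6}" "j \<in> {..<6}" using that by auto
    then show ?thesis unfolding lessThan_6
      by (elim insertE emptyE) (use that(1) vals w1 in \<open>simp_all\<close>)
  qed
  have "\<forall>c\<in>{..<15}. m + weight x c \<le> r"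
    unfolding lessThan_15 by (simp add: weight_def pairs_nth le[simplified] add.commute[of m])
  then have mw: "m + weight x c \<le> r" if "c < 15" for c using that by simp
  have wt: "\<forall>c<15. t + 2 * weight x c \<le> 2 * r"
  proof (intro allI impI)
    fix c :: nat assume "c < 15"
    from mw[OF this] show "t + 2 * weight x c \<le> 2 * r" using m by simp
  qed
  have "weight x 0 = w" using s1 by (simp add: weight_def pairs_nth x_def)
  then have "card (edge_class d 0 (edges (petersen b d x))) = w"
    by (simp add: card_edge_class_petersen)
  moreover have "vertices (petersen b d x) = {b..<b + 10}" "edges (petersen b d x) \<subseteq> {d..}"
    by (auto simp: petersen_def)
  ultimately show ?thesis
    using gadget_petersen[OF sum t(3) wt, of 0 b d] tight_petersen[OF sum, of 0 b d]
    by (metis zero_less_numeral)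
qed

text \<open>The conclusion records what repeated forking needs: edges keep their names, the stars of
  other vertices are unchanged, and families of disjoint matchings restrict to the old graph. The
  growing order later separates infinitely many examples.\<close>

lemma fork_exists:
  fixes G :: "(nat, nat) mgraph"
  assumes t: "even t" "4 \<le> t" "t \<le> r" and G: "well_cut r t G" and u: "u \<in> vertices G"
    and A: "A \<subseteq> inc G u" "t \<le> 2 * card A" "2 * card A + t \<le> 2 * r"
  shows "\<exists>G' :: (nat, nat) mgraph. well_cut r t G' \<and> edges G \<subseteq> edges G' \<and>
    (\<forall>v\<in>vertices G - {u}. v \<in> vertices G' \<and> inc G' v = inc G v) \<and>
    card (vertices G) < card (vertices G') \<and>
    (\<forall>N. matching_family (r - 2) G' N \<longrightarrow>
      matching_family (r - 2) G (\<lambda>i. N i \<inter> edges G) \<and> card (A - (\<Union>i<r - 2. N i)) = 1)"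
proof -
  have mg: "multigraph G" using G by (simp add: well_cut_def r_graph_def)
  define B where "B = inc G u - A"
  have "card (inc G u) = r"
    using G u by (simp add: well_cut_def r_graph_def regular_def degree_def inc_def)
  moreover have "finite (inc G u)" using mg by (simp add: inc_def multigraph_def)
  ultimately have cardB: "card B = r - card A" "card A \<le> r"
    using A(1) card_mono[of "inc G u" A] finite_subset[of A "inc G u"] by (auto simp: B_def card_Diff_subset)
  \<comment> \<open>Since \<open>card A + card B = r\<close>, each bound on \<open>A\<close> becomes
    the other bound on \<open>B\<close>.\<close>
  have tB: "t \<le> 2 * card B" "2 * card B + t \<le> 2 * r" using A cardB by auto
  have fin: "finite (vertices G)" "finite (edges G)" using mg by (auto simp: multigraph_def)
  obtain m where m: "\<forall>v\<in>vertices G. v < m"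
    using iffD1[OF finite_nat_set_iff_bounded fin(1)] by blast
  obtain d where d: "\<forall>e\<in>edges G. e < d"
    using iffD1[OF finite_nat_set_iff_bounded fin(2)] by blast
  obtain Q1 p1 q1 P1 where gQ1: "gadget r t Q1 p1 q1 P1" "card P1 = card A" "tight (r - 2) Q1 P1"
    "vertices Q1 = {m..<m + 10}" "edges Q1 \<subseteq> {d..}"
    using petersen_gadget_exists[OF t A(2,3), of m d] by blast
  have mg1: "multigraph Q1" using gQ1(1) by (simp add: gadget_def well_cut_def r_graph_def)
  have finE: "finite (edges G \<union> edges Q1)" using mg1 fin by (simp add: multigraph_def)
  obtain d' where d': "\<forall>e\<in>edges G \<union> edges Q1. e < d'"
    using iffD1[OF finite_nat_set_iff_bounded finE] by blast
  obtain Q2 p2 q2 P2 where gQ2: "gadget r t Q2 p2 q2 P2" "card P2 = card B" "tight (r - 2) Q2 P2"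
    "vertices Q2 = {m + 10..<m + 10 + 10}" "edges Q2 \<subseteq> {d'..}"
    using petersen_gadget_exists[OF t tB, of "m + 10" d'] by blast
  \<comment> \<open>The gadgets occupy the vertices from \<open>m\<close> to
    \<open>m + 19\<close>.\<close>
  define h where "h = m + 20"
  have Ed: "edges G \<inter> edges Q1 = {}" "edges G \<inter> edges Q2 = {}" "edges Q1 \<inter> edges Q2 = {}"
  proof -
    have "d \<le> e" if "e \<in> edges Q1" for e using gQ1(5) that by auto
    moreover have "d' \<le> e" if "e \<in> edges Q2" for e using gQ2(5) that by auto
    ultimately show "edges G \<inter> edges Q1 = {}" "edges G \<inter> edges Q2 = {}" "edges Q1 \<inter> edges Q2 = {}"
      using d d' by (meson Un_iff disjoint_iff not_le)+
  qed
  define G' where "G' = \<lparr>vertices = (vertices G - {u}) \<union> vertices Q1 \<union> vertices Q2 \<union> {h},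
    edges = edges G \<union> edges Q1 \<union> edges Q2,
    ends = (\<lambda>e. if e \<in> A then insert p1 (ends G e - {u}) else if e \<in> B then insert p2 (ends G e - {u})
      else if e \<in> edges G then ends G e else if e \<in> P1 then {h, q1} else if e \<in> P2 then {h, q2}
      else if e \<in> edges Q1 then ends Q1 e else ends Q2 e)\<rparr>"
  have sub: "A \<subseteq> edges G" "B \<subseteq> edges G" "P1 \<subseteq> edges Q1" "P2 \<subseteq> edges Q2" "A \<inter> B = {}" "A \<union> B = inc G u"
    using A(1) gQ1(1) gQ2(1) by (auto simp: B_def inc_def gadget_def)
  interpret fork r t G G' Q1 Q2 u h p1 q1 p2 q2 A B P1 P2
  proof
    show "h \<notin> vertices G" "h \<notin> vertices Q1" "h \<notin> vertices Q2"
      using m gQ1(4) gQ2(4) by (auto simp: h_def)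
    show "vertices G \<inter> vertices Q1 = {}" "vertices G \<inter> vertices Q2 = {}" "vertices Q1 \<inter> vertices Q2 = {}"
      using m gQ1(4) gQ2(4) by fastforce+
    show "ends G' e = ends G e" if "e \<in> edges G - inc G u" for e
      using that sub by (auto simp: G'_def)
    show "ends G' e = insert p1 (ends G e - {u})" if "e \<in> A" for e
      using that by (simp add: G'_def)
    show "ends G' e = insert p2 (ends G e - {u})" if "e \<in> B" for e
      using that sub by (auto simp: G'_def)
    show "ends G' e = ends Q1 e" if "e \<in> edges Q1 - P1" for e
    proof -
      have "e \<notin> A" "e \<notin> B" "e \<notin> edges G" "e \<notin> P2" using that sub Ed by auto
      then show ?thesis using that by (simp add: G'_def)
    qed
    show "ends G' e = ends Q2 e" if "e \<in> edges Q2 - P2" for e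
    proof -
      have "e \<notin> A" "e \<notin> B" "e \<notin> edges G" "e \<notin> P1" "e \<notin> edges Q1" using that sub Ed by auto
      then show ?thesis using that by (simp add: G'_def)
    qed
    show "ends G' e = {h, q1}" if "e \<in> P1" for e
    proof -
      have "e \<notin> A" "e \<notin> B" "e \<notin> edges G" using that sub Ed by auto
      then show ?thesis using that by (simp add: G'_def)
    qed
    show "ends G' e = {h, q2}" if "e \<in> P2" for e
    proof -
      have "e \<notin> A" "e \<notin> B" "e \<notin> edges G" "e \<notin> P1" using that sub Ed by auto
      then show ?thesis using that by (simp add: G'_def)
    qed
  qed (use G u sub A tB gQ1 gQ2 Ed in \<open>simp_all add: G'_def\<close>)
  have "edges G \<subseteq> edges G'" using E' by auto
  moreover have "\<forall>v\<in>vertices G - {u}. v \<in> vertices G' \<and> inc G' v = inc G v"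
    using inc_old V' by auto
  moreover have "card (vertices G) < card (vertices G')"
    using card_vertices gQ1(4) by simp
  ultimately show ?thesis using well_cut_fork family_G unused_A gQ1(3) gQ2(3) t by (intro exI[of _ G']) auto
qed

lemma forks_exist:
  fixes G :: "(nat, nat) mgraph"
  assumes t: "even t" "4 \<le> t" "t \<le> r" and G: "well_cut r t G" and "distinct (map fst us)"
    and "\<forall>(u, A)\<in>set us. u \<in> vertices G \<and> A \<subseteq> inc G u \<and> t \<le> 2 * card A \<and> 2 * card A + t \<le> 2 * r"
  shows "\<exists>G' :: (nat, nat) mgraph. well_cut r t G' \<and> edges G \<subseteq> edges G' \<and>
    (\<forall>N. matching_family (r - 2) G' N \<longrightarrow>
      matching_family (r - 2) G (\<lambda>i. N i \<inter> edges G) \<and> (\<forall>(u, A)\<in>set us. card (A - (\<Union>i<r - 2. N i)) = 1))"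
  using G assms(5,6)
proof (induction us arbitrary: G)
  case Nil
  have "matching_family (r - 2) G (\<lambda>i. N i \<inter> edges G)" if N: "matching_family (r - 2) G N" for N
  proof -
    have "N i \<inter> edges G = N i" if "i < r - 2" for i
      using N that by (auto simp: matching_family_def perfect_matching_def)
    then show ?thesis using N by (simp add: matching_family_def)
  qed
  then show ?case using Nil by (intro exI[of _ G]) auto
next
  case (Cons p us)
  obtain u A where p: "p = (u, A)" by (cases p)
  have uA: "u \<in> vertices G" "A \<subseteq> inc G u" "t \<le> 2 * card A" "2 * card A + t \<le> 2 * r"
    using Cons.prems p by auto
  obtain G1 :: "(nat, nat) mgraph" where G1: "well_cut r t G1" "edges G \<subseteq> edges G1"
    "\<forall>v\<in>vertices G - {u}. v \<in> vertices G1 \<and> inc G1 v = inc G v"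
    "\<And>N. matching_family (r - 2) G1 N \<Longrightarrow>
      matching_family (r - 2) G (\<lambda>i. N i \<inter> edges G) \<and> card (A - (\<Union>i<r - 2. N i)) = 1"
    using fork_exists[OF t Cons.prems(1) uA] by blast
  have "\<forall>(v, C)\<in>set us. v \<in> vertices G1 \<and> C \<subseteq> inc G1 v \<and> t \<le> 2 * card C \<and> 2 * card C + t \<le> 2 * r"
  proof (intro ballI, clarify)
    fix v C assume vC: "(v, C) \<in> set us"
    then have "v \<noteq> u" using Cons.prems(2) p by (auto simp: rev_image_eqI)
    moreover have old: "v \<in> vertices G" "C \<subseteq> inc G v" "t \<le> 2 * card C" "2 * card C + t \<le> 2 * r"
      using Cons.prems(3) vC by auto
    ultimately show "v \<in> vertices G1 \<and> C \<subseteq> inc G1 v \<and> t \<le> 2 * card C \<and> 2 * card C + t \<le> 2 * r"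
      using G1(3) by simp
  qed
  then obtain G' :: "(nat, nat) mgraph" where G': "well_cut r t G'" "edges G1 \<subseteq> edges G'"
    "\<And>N. matching_family (r - 2) G' N \<Longrightarrow>
      matching_family (r - 2) G1 (\<lambda>i. N i \<inter> edges G1) \<and> (\<forall>(u, A)\<in>set us. card (A - (\<Union>i<r - 2. N i)) = 1)"
    using Cons.IH[OF G1(1)] Cons.prems(2) by auto
  have "matching_family (r - 2) G (\<lambda>i. N i \<inter> edges G) \<and> (\<forall>(u, A)\<in>set (p # us). card (A - (\<Union>i<r - 2. N i)) = 1)"
    if N: "matching_family (r - 2) G' N" for N
  proof -
    have "(\<lambda>i. N i \<inter> edges G1 \<inter> edges G) = (\<lambda>i. N i \<inter> edges G)" using G1(2) by auto
    moreover have "A - (\<Union>i<r - 2. N i \<inter> edges G1) = A - (\<Union>i<r - 2. N i)"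
      using uA(2) G1(2) by (auto simp: inc_def)
    ultimately show ?thesis using G1(4)[of "\<lambda>i. N i \<inter> edges G1"] G'(3)[OF N] p by simp
  qed
  then show ?case using G' G1(2) by (intro exI[of _ G']) auto
qed

section \<open>The base graph and the theorem\<close>

text \<open>The numbers are the multiplicities of the matchings 0, 1 and, twice, of 2 and 3. The
  bounds make the classes 01, 02, 03 admissible as the set \<open>A\<close> of a fork. For
  \<open>r = 4 * k\<close> the upper and lower bounds coincide, so these classes have exactly
  \<open>2 * k\<close> edges.\<close>

lemma base_params:
  fixes r t :: nat
  assumes "r \<ge> 4" and "r mod 4 = 0 \<Longrightarrow> t = r" and "r mod 2 = 1 \<Longrightarrow> t = r - 1"
    and "r mod 4 = 2 \<Longrightarrow> t = r - 2"
  obtains x0 x1 z where "x0 + x1 + 2 * z + 3 = r" "even t" "4 \<le> t" "t \<le> r" "x1 \<le> x0" "z \<le> x0"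
    "t \<le> 2 * (1 + x0 + x1)" "2 * (1 + x0 + x1) + t \<le> 2 * r"
    "t \<le> 2 * (1 + x0 + z)" "2 * (1 + x0 + z) + t \<le> 2 * r"
proof -
  define k where "k = r div 4"
  have k: "1 \<le> k" using assms(1) unfolding k_def by simp
  have "r = 4 * k \<or> r = 4 * k + 1 \<or> r = 4 * k + 2 \<or> r = 4 * k + 3"
    unfolding k_def by presburger
  then consider "r = 4 * k" | "r = 4 * k + 1" | "r = 4 * k + 2" | "r = 4 * k + 3" by blast
  then show ?thesis
  proof cases
    case 1
    then have "t = 4 * k" using assms(2) by simp
    then show ?thesis using 1 k by (intro that[of k "k - 1" "k - 1"]) auto
  next
    case 2
    then have "r mod 2 = 1" by presburger
    then have "t = 4 * k" using assms(3) 2 by simp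
    then show ?thesis using 2 k by (intro that[of k k "k - 1"]) auto
  next
    case 3
    then have "r mod 4 = 2" by presburger
    then have "t = 4 * k" using assms(4) 3 by simp
    then show ?thesis using 3 k by (intro that[of "k + 1" k "k - 1"]) auto
  next
    case 4
    then have "r mod 2 = 1" by presburger
    then have "t = 4 * k + 2" using assms(3) 4 by simp
    then show ?thesis using 4 k by (intro that[of k k k]) auto
  qed
qed

lemma base_exists:
  fixes r t x0 x1 z :: nat
  assumes r: "x0 + x1 + 2 * z + 3 = r" and t: "even t" "4 \<le> t" "t \<le> r" and le: "x1 \<le> x0" "z \<le> x0"
    and w1: "t \<le> 2 * (1 + x0 + x1)" "2 * (1 + x0 + x1) + t \<le> 2 * r"
    and w2: "t \<le> 2 * (1 + x0 + z)" "2 * (1 + x0 + z) + t \<le> 2 * r"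
  shows "\<exists>G :: (nat, nat) mgraph. well_cut r t G \<and> (\<forall>N. \<not> matching_family (r - 2) G N)"
proof -
  define x where "x a = (if a = 0 then x0 else if a = 1 then x1 else if a = 2 \<or> a = 3 then z else 0)" for a :: nat
  have sum: "(\<Sum>a<6. x a) + 3 = r" using r by (simp add: lessThan_6 x_def)
  define G where "G = petersen 0 0 x"
  define E where "E c = edge_class 0 c (edges G)" for c
  have cardE: "card (E c) = weight x c" if "c < 15" for c
    using that by (simp add: E_def G_def card_edge_class_petersen)
  have finE: "finite (E c)" for c
    using finite_petersen by (simp add: E_def G_def edge_class_def)
  have "t + 2 * (1 + x i + x j) \<le> 2 * r" if "i \<noteq> j" for i j
  proof -
    have "1 + x i + x j \<le> 1 + x0 + x1 \<or> 1 + x i + x j \<le> 1 + x0 + z"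
      using le that by (auto simp: x_def)
    then show ?thesis using w1(2) w2(2) by auto
  qed
  then have "\<forall>c<15. t + 2 * weight x c \<le> 2 * r"
    using pairs_pends_bounds by (simp add: weight_def)
  from well_cut_petersen[OF sum t(3) this] have wc: "well_cut r t G" by (simp add: G_def)
  have wts: "weight x 0 = 1 + x0 + x1" "weight x 1 = 1 + x0 + z" "weight x 2 = 1 + x0 + z"
    "weight x 3 = 1 + x0" "weight x 4 = 1 + x0" "weight x 9 = 1 + 2 * z"
    by (simp_all add: weight_def pairs_nth x_def)
  \<comment> \<open>The classes 3 and 4 have only \<open>1 + x0\<close> edges, possibly too few for
    a fork; both are filled up with the same \<open>z\<close> edges of class 9.\<close>
  obtain Z where Z: "Z \<subseteq> E 9" "card Z = z"
    using obtain_subset_with_card_n[of z "E 9"] cardE[of 9] wts by auto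
  have finZ: "finite Z" using Z(1) finE finite_subset by blast
  have disj: "E c \<inter> E c' = {}" if "c \<noteq> c'" for c c'
    using that by (auto simp: E_def edge_class_def)
  have incE: "E c \<subseteq> inc G v" if "fst (pends ! c) = v \<or> snd (pends ! c) = v" for c v
    using that by (auto simp: E_def edge_class_def inc_def G_def petersen_def)
  have cardEZ: "card (E c \<union> Z) = 1 + x0 + z" if "c = 3 \<or> c = 4" for c
  proof -
    have "E c \<inter> E 9 = {}" using disj[of c 9] that by auto
    then have "E c \<inter> Z = {}" using Z(1) by blast
    then show ?thesis using that card_Un_disjoint[OF finE finZ] Z(2) cardE wts by auto
  qed
  \<comment> \<open>Each class is taken at one of its ends in \<open>pends\<close>. The vertices 7
    and 9 are the two ends of class 9, so \<open>Z\<close> is available at both.\<close>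
  define us where "us = [(0 :: nat, E 0), (2, E 1), (4, E 2), (7, E 3 \<union> Z), (9, E 4 \<union> Z)]"
  have "distinct (map fst us)" by (simp add: us_def)
  moreover have "\<forall>(u, A)\<in>set us. u \<in> vertices G \<and> A \<subseteq> inc G u \<and> t \<le> 2 * card A \<and> 2 * card A + t \<le> 2 * r"
  proof -
    have "{0, 2, 4, 7, 9} \<subseteq> vertices G" by (simp add: G_def petersen_def)
    moreover have "E 0 \<subseteq> inc G 0" "E 1 \<subseteq> inc G 2" "E 2 \<subseteq> inc G 4" "E 3 \<subseteq> inc G 7" "E 9 \<subseteq> inc G 7"
      "E 4 \<subseteq> inc G 9" "E 9 \<subseteq> inc G 9"
      by (rule incE; simp add: pends_nth)+
    moreover have "card (E 0) = 1 + x0 + x1" "card (E 1) = 1 + x0 + z" "card (E 2) = 1 + x0 + z"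
      using cardE wts by simp_all
    ultimately show ?thesis using Z(1) w1 w2 cardEZ[of 3] cardEZ[of 4] by (auto simp: us_def)
  qed
  ultimately obtain H :: "(nat, nat) mgraph" where H: "well_cut r t H"
    "\<And>N. matching_family (r - 2) H N \<Longrightarrow>
      matching_family (r - 2) G (\<lambda>i. N i \<inter> edges G) \<and> (\<forall>(u, A)\<in>set us. card (A - (\<Union>i<r - 2. N i)) = 1)"
    using forks_exist[OF t wc, of us] by blast
  have "\<not> matching_family (r - 2) H N" for N
  proof
    assume "matching_family (r - 2) H N"
    note N = H(2)[OF this]
    define U where "U = (\<Union>i<r - 2. N i)"
    have "E c - (\<Union>i<r - 2. N i \<inter> edges G) = E c - U" for c
      by (auto simp: E_def edge_class_def U_def)
    then obtain j where j: "j < 6" "\<And>c. c < 15 \<Longrightarrow> card (E c - U) = (if in_pair j c then 0 else 1)"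
      using matching_family_petersen[OF sum, of 0 0 "\<lambda>i. N i \<inter> edges G"] N by (auto simp: G_def E_def)
    have unused: "card (E 0 - U) = 1" "card (E 1 - U) = 1" "card (E 2 - U) = 1"
      "card ((E 3 \<union> Z) - U) = 1" "card ((E 4 \<union> Z) - U) = 1"
      using N unfolding us_def U_def by simp_all
    have split: "card ((E c \<union> Z) - U) = card (E c - U) + card (Z - U)" if "c = 3 \<or> c = 4" for c
    proof -
      have "E c \<inter> E 9 = {}" using disj[of c 9] that by auto
      then have "(E c - U) \<inter> (Z - U) = {}" using Z(1) by blast
      then show ?thesis using finE finZ by (simp add: Un_Diff card_Un_disjoint)
    qed
    \<comment> \<open>The forks at 0, 2, 4 leave only \<open>j \<in> {4, 5}\<close>; by the forks at 7 and 9, the classes 04 and 05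
      have equally many unused edges, contrary to \<open>j \<in> {4, 5}\<close>.\<close>
    have "\<not> in_pair j 0" "\<not> in_pair j 1" "\<not> in_pair j 2"
      using unused(1-3) j(2)[of 0] j(2)[of 1] j(2)[of 2] by auto
    then have "j \<noteq> 0" "j \<noteq> 1" "j \<noteq> 2" "j \<noteq> 3" by (auto simp: in_pair_def pairs_nth)
    then have "j = 4 \<or> j = 5" using j(1) by auto
    then have "in_pair j 3 \<longleftrightarrow> \<not> in_pair j 4" by (auto simp: in_pair_def pairs_nth)
    then have "card (E 3 - U) \<noteq> card (E 4 - U)" using j(2)[of 3] j(2)[of 4] by auto
    then show False using split[of 3] split[of 4] unused(4,5) by simp
  qed
  then show ?thesis using H(1) by blast
qed

section \<open>Infinitely many examples\<close>

lemma isomorphic_card_vertices: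
  "isomorphic G H \<Longrightarrow> card (vertices G) = card (vertices H)"
  by (auto simp: isomorphic_def dest: bij_betw_same_card)

theorem theorem1p1:
  fixes r t :: nat
  assumes "r \<ge> 4"
    and "r mod 4 = 0 \<Longrightarrow> t = r"
    and "r mod 2 = 1 \<Longrightarrow> t = r - 1"
    and "r mod 4 = 2 \<Longrightarrow> t = r - 2"
  shows "infinitely_many_graphs
           (\<lambda>G. r_graph r G \<and> edge_connected t G \<and> \<not> has_disjoint_one_factors (r - 2) G)"
proof -
  define P where "P G \<longleftrightarrow> well_cut r t G \<and> (\<forall>N. \<not> matching_family (r - 2) G N)"
    for G :: "(nat, nat) mgraph"
  obtain x0 x1 z where p: "x0 + x1 + 2 * z + 3 = r" "even t" "4 \<le> t" "t \<le> r" "x1 \<le> x0" "z \<le> x0"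
    "t \<le> 2 * (1 + x0 + x1)" "2 * (1 + x0 + x1) + t \<le> 2 * r"
    "t \<le> 2 * (1 + x0 + z)" "2 * (1 + x0 + z) + t \<le> 2 * r"
    using base_params[OF assms] by blast
  have base: "\<exists>G. P G" using base_exists[OF p] by (simp add: P_def)
  \<comment> \<open>Fork any vertex with \<open>card A = t div 2\<close>: a forbidden family in the
    larger graph would restrict to one in \<open>G\<close>.\<close>
  have step: "\<exists>G'. P G' \<and> card (vertices G) < card (vertices G')" if "P G" for G
  proof -
    have wc: "well_cut r t G" using that by (simp add: P_def)
    then have "vertices G \<noteq> {}" by (auto simp: well_cut_def)
    then obtain u where u: "u \<in> vertices G" by blast
    have "card (inc G u) = r"
      using wc u by (simp add: well_cut_def r_graph_def regular_def degree_def inc_def)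
    then have "t div 2 \<le> card (inc G u)" using p(4) by simp
    then obtain A where A: "A \<subseteq> inc G u" "card A = t div 2"
      by (rule obtain_subset_with_card_n)
    have "t \<le> 2 * card A" "2 * card A + t \<le> 2 * r" using A(2) p(2,4) by simp_all
    from fork_exists[OF p(2-4) wc u A(1) this]
    obtain G' :: "(nat, nat) mgraph" where G': "well_cut r t G'" "card (vertices G) < card (vertices G')"
      "\<And>N. matching_family (r - 2) G' N \<Longrightarrow> matching_family (r - 2) G (\<lambda>i. N i \<inter> edges G)"
      by blast
    have "P G'" using that G'(1,3) unfolding P_def by blast
    then show ?thesis using G'(2) by blast
  qed
  obtain f where f: "\<And>n. P (f n)" "\<And>n. card (vertices (f n)) < card (vertices (f (Suc n)))"
    using dependent_nat_choice[of "\<lambda>_. P" "\<lambda>_ G G'. card (vertices G) < card (vertices G')"] base step by metis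
  \<comment> \<open>Strictly increasing orders make the graphs \<open>f n\<close> pairwise
    nonisomorphic.\<close>
  have mono: "strict_mono (\<lambda>n. card (vertices (f n)))" using f(2) by (simp add: strict_mono_Suc_iff)
  have eq: "n = m" if "card (vertices (f n)) = card (vertices (f m))" for n m
    using strict_mono_eq[OF mono] that by blast
  then have "inj f" by (intro injI) simp
  then have "infinite (range f)" by (simp add: finite_image_iff)
  moreover have "r_graph r G \<and> edge_connected t G \<and> \<not> has_disjoint_one_factors (r - 2) G" if "P G" for G
    using that well_cut_edge_connected disjoint_one_factors_matching_family[of "r - 2" G]
    by (auto simp: P_def well_cut_def)
  moreover have "G = H" if "G \<in> range f" "H \<in> range f" "isomorphic G H" for G H
    using that eq isomorphic_card_vertices by blast
  ultimately show ?thesis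
    unfolding infinitely_many_graphs_def using f(1) by (intro exI[of _ "range f"]) auto
qed

end
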